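(* Let $\mathcal Q$ be the set of all rationalizable pairs $q=(q_1,q_2)$ of nondecreasing left-continuous functions $q_i:[0,1]\to[0,1]$. Then $q=(q_1,q_2)$ is an extreme point of $\mathcal Q$ if and only if $q$ is rationalized by $\mathbf 1_A$ for some up-set $A\subseteq[0,1]^2$. Moreover, every extreme point of $\mathcal Q$ is uniquely rationalized.
   Context: A pair $q=(q_1,q_2)$ is rationalized by a (measurable, not necessarily monotone) function $f:[0,1]^2\to[0,1]$ if $q_1(x_1)=\int_0^1 f(x_1,x_2)\,dx_2$ and $q_2(x_2)=\int_0^1 f(x_1,x_2)\,dx_1$ for all $x_1,x_2\in[0,1]$; $q$ is rationalizable if some such $f$ exists. $q$ is uniquely rationalized (by $f$) if $f$ rationalizes $q$ and any function $\tilde f:[0,1]^2\to[0,1]$ (not necessarily monotone) that also rationalizes $q$ equals $f$ up to measure zero. Functions are viewed as elements of $L^1$, i.e. identified when equal almost everywhere (so the value of $q_i$ at $0$ is immaterial and the rationalization identities are understood almost everywhere). A set $A\subseteq[0,1]^2$ is an up-set if $x\in A$, $y\ge x$ (component-wise) imply $y\in A$. *)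

theory Defs
  imports "HOL-Analysis.Analysis"
begin

abbreviation unit_square :: "(real \<times> real) set" where
  "unit_square \<equiv> {0..1} \<times> {0..1}"

(* Lebesgue rather than Borel measurability: up-sets are Lebesgue measurable but need not be
   Borel. Sections of a Lebesgue measurable function are measurable only almost everywhere,
   which is enough because the marginal identities are themselves required only a.e. *)
definition rationalizes ::
  "(real \<times> real \<Rightarrow> real) \<Rightarrow> (real \<Rightarrow> real) \<times> (real \<Rightarrow> real) \<Rightarrow> bool" where
  "rationalizes f q \<longleftrightarrow>
     f \<in> borel_measurable (lebesgue_on unit_square) \<and>
     f \<in> unit_square \<rightarrow> {0..1} \<and>
     (AE x1 in lebesgue_on {0..1}. fst q x1 = (LINT x2|lebesgue_on {0..1}. f (x1, x2))) \<and>
     (AE x2 in lebesgue_on {0..1}. snd q x2 = (LINT x1|lebesgue_on {0..1}. f (x1, x2)))"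

definition rationalizable :: "(real \<Rightarrow> real) \<times> (real \<Rightarrow> real) \<Rightarrow> bool" where
  "rationalizable q \<longleftrightarrow> (\<exists>f. rationalizes f q)"

definition uniquely_rationalizes ::
  "(real \<times> real \<Rightarrow> real) \<Rightarrow> (real \<Rightarrow> real) \<times> (real \<Rightarrow> real) \<Rightarrow> bool" where
  "uniquely_rationalizes f q \<longleftrightarrow>
     rationalizes f q \<and>
     (\<forall>g. rationalizes g q \<longrightarrow> (AE x in lebesgue_on unit_square. g x = f x))"

definition uniquely_rationalized :: "(real \<Rightarrow> real) \<times> (real \<Rightarrow> real) \<Rightarrow> bool" where
  "uniquely_rationalized q \<longleftrightarrow> (\<exists>f. uniquely_rationalizes f q)"

(* Left-continuity of a function on [0,1] is no condition at the left endpoint 0. *)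
definition monotone_lc :: "(real \<Rightarrow> real) \<Rightarrow> bool" where
  "monotone_lc h \<longleftrightarrow>
     h \<in> {0..1} \<rightarrow> {0..1} \<and> mono_on {0..1} h \<and> (\<forall>x\<in>{0<..1}. continuous (at_left x) h)"

definition rationalizable_pairs :: "((real \<Rightarrow> real) \<times> (real \<Rightarrow> real)) set" where
  "rationalizable_pairs = {q. monotone_lc (fst q) \<and> monotone_lc (snd q) \<and> rationalizable q}"

(* On pairs, the library order \<le> is the component-wise one (less_eq_prod_def). *)
definition up_set :: "(real \<times> real) set \<Rightarrow> bool" where
  "up_set A \<longleftrightarrow> A \<subseteq> unit_square \<and> (\<forall>x\<in>A. \<forall>y\<in>unit_square. x \<le> y \<longrightarrow> y \<in> A)"

definition ae_eq ::
  "(real \<Rightarrow> real) \<times> (real \<Rightarrow> real) \<Rightarrow> (real \<Rightarrow> real) \<times> (real \<Rightarrow> real) \<Rightarrow> bool" where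
  "ae_eq p q \<longleftrightarrow>
     (AE t in lebesgue_on {0..1}. fst p t = fst q t) \<and>
     (AE t in lebesgue_on {0..1}. snd p t = snd q t)"

definition mixture ::
  "real \<Rightarrow> (real \<Rightarrow> real) \<times> (real \<Rightarrow> real) \<Rightarrow> (real \<Rightarrow> real) \<times> (real \<Rightarrow> real)
     \<Rightarrow> (real \<Rightarrow> real) \<times> (real \<Rightarrow> real)" where
  "mixture u p r =
     ((\<lambda>t. (1 - u) * fst p t + u * fst r t), (\<lambda>t. (1 - u) * snd p t + u * snd r t))"

(* The library's extreme_point_of, unfolded, with equality in L^1 (pairs of functions modulo
   null sets, represented here by functions) in place of equality of vectors. *)
definition L1_extreme_point_of ::
  "(real \<Rightarrow> real) \<times> (real \<Rightarrow> real) \<Rightarrow> ((real \<Rightarrow> real) \<times> (real \<Rightarrow> real)) set \<Rightarrow> bool"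
  (infixr "L1'_extreme'_point'_of" 50) where
  "q L1_extreme_point_of S \<longleftrightarrow>
     q \<in> S \<and>
     (\<forall>p\<in>S. \<forall>r\<in>S. \<not> (\<not> ae_eq p r \<and> (\<exists>u. 0 < u \<and> u < 1 \<and> ae_eq q (mixture u p r))))"

end

theory Submission
  imports Defs "HOL-Probability.Probability"
begin

text \<open>
Among all rationalizations of a monotone pair take one of least \<open>L\<^sup>2\<close> norm. For columns \<open>x\<close>, \<open>x'\<close> it
cannot be improved by moving mass between them where \<open>f (x, y) - f (x', y)\<close> has either sign, in
the proportion that keeps both marginals; hence the columns are almost everywhere comparable, and
the one with the larger marginal lies above the other. So \<open>f\<close> is monotone in each coordinate, and
\<open>min 1 (2 * f)\<close> and \<open>max 0 (2 * f - 1)\<close>, whose mean is \<open>f\<close>, have monotone marginals too. At an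
extreme point these marginals agree, which forces \<open>f\<close> to be the indicator of an up-set.
Conversely, an up-set is \<open>{(x, y). g x \<le> y}\<close> for a decreasing \<open>g\<close>, up to a null set; any other \<open>h\<close>
with the same marginals satisfies \<open>\<integral> (indicator A - h) * (y - g x) = 0\<close> with a nonnegative
integrand, so \<open>h = indicator A\<close> almost everywhere, and a uniquely rationalized indicator is extreme.
\<close>

subsection \<open>Rationalizations of least norm\<close>

text \<open>The sum of the absolute increments has finite integral, so it is finite almost
  everywhere, and there the telescoping series converges absolutely. This extracts a pointwise limit
  from a minimizing sequence.\<close>

lemma (in prob_space) AE_convergent_if_summable_steps:
  fixes g :: "nat \<Rightarrow> 'a \<Rightarrow> real"
  assumes g: "\<And>n. integrable M (g n)"
    and sm: "summable (\<lambda>n. \<integral>x. \<bar>g (Suc n) x - g n x\<bar> \<partial>M)"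
  shows "AE x in M. convergent (\<lambda>n. g n x)"
proof -
  have [measurable]: "g n \<in> borel_measurable M" for n
    using g by auto
  have "(\<integral>\<^sup>+x. (\<Sum>n. ennreal \<bar>g (Suc n) x - g n x\<bar>) \<partial>M)
      = (\<Sum>n. \<integral>\<^sup>+x. ennreal \<bar>g (Suc n) x - g n x\<bar> \<partial>M)"
    by (intro nn_integral_suminf) auto
  also have "\<dots> = (\<Sum>n. ennreal (\<integral>x. \<bar>g (Suc n) x - g n x\<bar> \<partial>M))"
    using g by (intro suminf_cong nn_integral_eq_integral) auto
  also have "\<dots> \<noteq> \<infinity>"
    unfolding infinity_ennreal_def by (intro ennreal_suminf_neq_top[OF sm]) simp
  finally have "AE x in M. (\<Sum>n. ennreal \<bar>g (Suc n) x - g n x\<bar>) \<noteq> \<infinity>"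
    by (intro nn_integral_PInf_AE) auto
  then show ?thesis
  proof eventually_elim
    case (elim x)
    then have "summable (\<lambda>n. \<bar>g (Suc n) x - g n x\<bar>)"
      by (intro summable_suminf_not_top) auto
    then have "summable (\<lambda>n. g (Suc n) x - g n x)"
      by (rule summable_rabs_cancel)
    then have "convergent (\<lambda>n. \<Sum>i<n. g (Suc i) x - g i x)"
      by (simp add: summable_iff_convergent)
    then have "convergent (\<lambda>n. g n x - g 0 x)"
      by (simp only: sum_lessThan_telescope[of "\<lambda>n. g n x"])
    then show ?case
      by (simp add: convergent_diff_const_right_iff)
  qed
qed

lemma (in pair_prob_space) AE_swap:
  assumes "AE z in M1 \<Otimes>\<^sub>M M2. Q z"
  shows "AE z in M2 \<Otimes>\<^sub>M M1. Q (prod.swap z)"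
proof -
  have swap_eq: "prod.swap = (\<lambda>(x, y). (y, x))"
    by auto
  have "AE z in distr (M2 \<Otimes>\<^sub>M M1) (M1 \<Otimes>\<^sub>M M2) prod.swap. Q z"
    using assms unfolding swap_eq distr_pair_swap[symmetric] .
  then show ?thesis
    by (rule AE_distrD[rotated]) (simp add: swap_eq)
qed

lemma (in pair_prob_space) AE_pair_snd:
  assumes "AE z in M1 \<Otimes>\<^sub>M M2. Q z"
  shows "AE y in M2. AE x in M1. Q (x, y)"
proof -
  interpret Q: pair_prob_space M2 M1 ..
  show ?thesis
    using Q.AE_pair[OF AE_swap[OF assms]] by simp
qed

lemma (in pair_prob_space) AE_fst:
  assumes "AE x in M1. Q x"
  shows "AE z in M1 \<Otimes>\<^sub>M M2. Q (fst z)"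
proof (rule AE_distrD[of fst _ M1])
  show "AE x in distr (M1 \<Otimes>\<^sub>M M2) M1 fst. Q x"
    using assms by (simp only: M2.distr_pair_fst)
qed simp

lemma (in pair_prob_space) AE_snd:
  assumes "AE y in M2. Q y"
  shows "AE z in M1 \<Otimes>\<^sub>M M2. Q (snd z)"
proof -
  interpret Q: pair_prob_space M2 M1 ..
  show ?thesis
    using Q.AE_swap[OF Q.AE_fst[OF assms]] by simp
qed

section \<open>Functions on a product with prescribed marginals\<close>

text \<open>The counterpart of \<open>rationalizes\<close> on abstract probability spaces.
  Measurability for the product sigma-algebra makes every section measurable, and the symmetric form
  lets the two coordinates be swapped.\<close>

definition has_marginals ::
  "'a measure \<Rightarrow> 'b measure \<Rightarrow> ('a \<times> 'b \<Rightarrow> real) \<Rightarrow> ('a \<Rightarrow> real) \<Rightarrow> ('b \<Rightarrow> real) \<Rightarrow> bool" where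
  "has_marginals M N f a b \<longleftrightarrow>
     f \<in> borel_measurable (M \<Otimes>\<^sub>M N) \<and>
     f \<in> space (M \<Otimes>\<^sub>M N) \<rightarrow> {0..1} \<and>
     (AE x in M. a x = (\<integral>y. f (x, y) \<partial>N)) \<and>
     (AE y in N. b y = (\<integral>x. f (x, y) \<partial>M))"

definition minimal_energy ::
  "'a measure \<Rightarrow> 'b measure \<Rightarrow> ('a \<times> 'b \<Rightarrow> real) \<Rightarrow> ('a \<Rightarrow> real) \<Rightarrow> ('b \<Rightarrow> real) \<Rightarrow> bool" where
  "minimal_energy M N f a b \<longleftrightarrow>
     has_marginals M N f a b \<and>
     (\<forall>h. has_marginals M N h a b \<longrightarrow>
        (\<integral>z. (f z)\<^sup>2 \<partial>(M \<Otimes>\<^sub>M N)) \<le> (\<integral>z. (h z)\<^sup>2 \<partial>(M \<Otimes>\<^sub>M N)))"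

context pair_prob_space
begin

lemma has_marginals_swap:
  assumes "has_marginals M1 M2 f a b"
  shows "has_marginals M2 M1 (f \<circ> prod.swap) b a"
proof -
  have [measurable]: "f \<in> borel_measurable (M1 \<Otimes>\<^sub>M M2)"
    using assms by (simp add: has_marginals_def)
  have "(f \<circ> prod.swap) \<in> borel_measurable (M2 \<Otimes>\<^sub>M M1)"
    unfolding comp_def prod.swap_def by measurable
  with assms show ?thesis
    by (auto simp: has_marginals_def space_pair_measure Pi_iff)
qed

text \<open>Transposition permutes the admissible functions and preserves the energy, so whatever
  holds for the columns of a minimizer also holds for its rows.\<close>

lemma minimal_energy_swap:
  assumes f: "minimal_energy M1 M2 f a b"
  shows "minimal_energy M2 M1 (f \<circ> prod.swap) b a"
  unfolding minimal_energy_def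
proof (intro conjI allI impI)
  interpret Q: pair_prob_space M2 M1 ..
  have energy_swap: "(\<integral>z. ((h \<circ> prod.swap) z)\<^sup>2 \<partial>(M2 \<Otimes>\<^sub>M M1)) = (\<integral>z. (h z)\<^sup>2 \<partial>(M1 \<Otimes>\<^sub>M M2))"
    if "has_marginals M1 M2 h a b" for h
  proof -
    have "(\<lambda>z. ((h \<circ> prod.swap) z)\<^sup>2) = (\<lambda>(x, y). (h (y, x))\<^sup>2)"
      by auto
    moreover have "(\<lambda>z. (h z)\<^sup>2) \<in> borel_measurable (M1 \<Otimes>\<^sub>M M2)"
      using that by (auto simp: has_marginals_def)
    ultimately show ?thesis
      using integral_product_swap[of "\<lambda>z. (h z)\<^sup>2"] by simp
  qed
  have fm: "has_marginals M1 M2 f a b"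
    using f by (simp add: minimal_energy_def)
  show "has_marginals M2 M1 (f \<circ> prod.swap) b a"
    by (rule has_marginals_swap) fact
  fix h assume "has_marginals M2 M1 h b a"
  from Q.has_marginals_swap[OF this]
  have hs: "has_marginals M1 M2 (h \<circ> prod.swap) a b" .
  have "(\<integral>z. ((f \<circ> prod.swap) z)\<^sup>2 \<partial>(M2 \<Otimes>\<^sub>M M1)) = (\<integral>z. (f z)\<^sup>2 \<partial>(M1 \<Otimes>\<^sub>M M2))"
    by (rule energy_swap) fact
  also have "\<dots> \<le> (\<integral>z. ((h \<circ> prod.swap) z)\<^sup>2 \<partial>(M1 \<Otimes>\<^sub>M M2))"
    using f hs unfolding minimal_energy_def by blast
  also have "\<dots> = (\<integral>z. (((h \<circ> prod.swap) \<circ> prod.swap) z)\<^sup>2 \<partial>(M2 \<Otimes>\<^sub>M M1))"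
    using energy_swap[OF hs] by simp
  also have "\<dots> = (\<integral>z. (h z)\<^sup>2 \<partial>(M2 \<Otimes>\<^sub>M M1))"
    by (simp add: comp_assoc)
  finally show "(\<integral>z. ((f \<circ> prod.swap) z)\<^sup>2 \<partial>(M2 \<Otimes>\<^sub>M M1)) \<le> (\<integral>z. (h z)\<^sup>2 \<partial>(M2 \<Otimes>\<^sub>M M1))" .
qed

lemma integrable_section_fst:
  assumes "f \<in> borel_measurable (M1 \<Otimes>\<^sub>M M2)" "f \<in> space (M1 \<Otimes>\<^sub>M M2) \<rightarrow> {0..1::real}" "x \<in> space M1"
  shows "integrable M2 (\<lambda>y. f (x, y))"
  using assms
  by (intro M2.integrable_const_bound[where B = 1]) (auto simp: space_pair_measure Pi_iff)

lemma integrable_section_snd: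
  assumes "f \<in> borel_measurable (M1 \<Otimes>\<^sub>M M2)" "f \<in> space (M1 \<Otimes>\<^sub>M M2) \<rightarrow> {0..1::real}" "y \<in> space M2"
  shows "integrable M1 (\<lambda>x. f (x, y))"
  using assms
  by (intro M1.integrable_const_bound[where B = 1]) (auto simp: space_pair_measure Pi_iff)

lemma has_marginals_convex:
  assumes f: "has_marginals M1 M2 f a b" and h: "has_marginals M1 M2 h c d"
    and u: "0 \<le> u" "u \<le> 1"
  shows "has_marginals M1 M2 (\<lambda>z. (1 - u) * f z + u * h z)
           (\<lambda>x. (1 - u) * a x + u * c x) (\<lambda>y. (1 - u) * b y + u * d y)"
proof -
  have [measurable]: "f \<in> borel_measurable (M1 \<Otimes>\<^sub>M M2)" "h \<in> borel_measurable (M1 \<Otimes>\<^sub>M M2)"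
    and fr: "f \<in> space (M1 \<Otimes>\<^sub>M M2) \<rightarrow> {0..1}" and hr: "h \<in> space (M1 \<Otimes>\<^sub>M M2) \<rightarrow> {0..1}"
    and ae: "AE x in M1. a x = (\<integral>y. f (x, y) \<partial>M2)" "AE x in M1. c x = (\<integral>y. h (x, y) \<partial>M2)"
       "AE y in M2. b y = (\<integral>x. f (x, y) \<partial>M1)" "AE y in M2. d y = (\<integral>x. h (x, y) \<partial>M1)"
    using f h by (auto simp: has_marginals_def)
  have "(1 - u) * f z + u * h z \<in> {0..1}" if "z \<in> space (M1 \<Otimes>\<^sub>M M2)" for z
    using convex_bound_le[of "f z" 1 "h z" "1 - u" u] fr hr u that by (auto simp: Pi_iff)
  moreover have "AE x in M1. (1 - u) * a x + u * c x = (\<integral>y. (1 - u) * f (x, y) + u * h (x, y) \<partial>M2)"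
    using ae(1,2) AE_space
    by eventually_elim (simp add: integrable_section_fst fr hr)
  moreover have "AE y in M2. (1 - u) * b y + u * d y = (\<integral>x. (1 - u) * f (x, y) + u * h (x, y) \<partial>M1)"
    using ae(3,4) AE_space
    by eventually_elim (simp add: integrable_section_snd fr hr)
  ultimately show ?thesis
    by (auto simp: has_marginals_def)
qed

text \<open>By Fubini almost every section converges almost everywhere, and it is bounded by 1, so
  dominated convergence applies to it; the marginals are constant along the sequence.\<close>

lemma has_marginals_limit:
  assumes g: "\<And>n. has_marginals M1 M2 (g n) a b"
    and f: "f \<in> borel_measurable (M1 \<Otimes>\<^sub>M M2)" "f \<in> space (M1 \<Otimes>\<^sub>M M2) \<rightarrow> {0..1}"
    and lim: "AE z in M1 \<Otimes>\<^sub>M M2. (\<lambda>n. g n z) \<longlonglongrightarrow> f z"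
  shows "has_marginals M1 M2 f a b"
proof -
  have gm[measurable]: "g n \<in> borel_measurable (M1 \<Otimes>\<^sub>M M2)"
    and gr: "g n \<in> space (M1 \<Otimes>\<^sub>M M2) \<rightarrow> {0..1}" for n
    using g by (auto simp: has_marginals_def)
  note f(1)[measurable]
  have "AE x in M1. \<forall>n. a x = (\<integral>y. g n (x, y) \<partial>M2)"
    using g by (simp add: AE_all_countable has_marginals_def)
  then have "AE x in M1. a x = (\<integral>y. f (x, y) \<partial>M2)"
    using AE_pair[OF lim] AE_space
  proof eventually_elim
    case (elim x)
    have "(\<lambda>n. \<integral>y. g n (x, y) \<partial>M2) \<longlonglongrightarrow> (\<integral>y. f (x, y) \<partial>M2)"
      by (rule integral_dominated_convergence[where w = "\<lambda>_. 1"])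
        (use elim gr in \<open>auto simp: space_pair_measure Pi_iff\<close>)
    with elim(1) show ?case
      by (simp add: LIMSEQ_const_iff)
  qed
  moreover have "AE y in M2. \<forall>n. b y = (\<integral>x. g n (x, y) \<partial>M1)"
    using g by (simp add: AE_all_countable has_marginals_def)
  then have "AE y in M2. b y = (\<integral>x. f (x, y) \<partial>M1)"
    using AE_pair_snd[OF lim] AE_space
  proof eventually_elim
    case (elim y)
    have "(\<lambda>n. \<integral>x. g n (x, y) \<partial>M1) \<longlonglongrightarrow> (\<integral>x. f (x, y) \<partial>M1)"
      by (rule integral_dominated_convergence[where w = "\<lambda>_. 1"])
        (use elim gr in \<open>auto simp: space_pair_measure Pi_iff\<close>)
    with elim(1) show ?case
      by (simp add: LIMSEQ_const_iff)
  qed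
  ultimately show ?thesis
    using f by (simp add: has_marginals_def)
qed

lemma integrable_of_has_marginals:
  assumes "has_marginals M1 M2 f a b"
  shows "integrable (M1 \<Otimes>\<^sub>M M2) f"
  using assms
  by (intro P.integrable_const_bound[where B = 1]) (auto simp: has_marginals_def Pi_iff)

lemma integrable_mult_of_has_marginals:
  assumes "has_marginals M1 M2 f a b" "has_marginals M1 M2 h c d"
  shows "integrable (M1 \<Otimes>\<^sub>M M2) (\<lambda>z. f z * h z)"
  using assms
  by (intro P.integrable_const_bound[where B = 1])
    (auto simp: has_marginals_def Pi_iff abs_mult intro!: mult_le_one)

section \<open>Existence of a minimizer and its first-order condition\<close>

text \<open>The midpoint of two admissible functions is admissible, so by the parallelogram identity
  consecutive terms of a minimizing sequence are close in L2. At a geometric rate the sequence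
  converges almost everywhere, and its limit is admissible with least energy.\<close>

lemma ex_minimal_energy:
  assumes "has_marginals M1 M2 f0 a b"
  shows "\<exists>f. minimal_energy M1 M2 f a b"
proof -
  let ?K = "{h. has_marginals M1 M2 h a b}"
  let ?E = "\<lambda>h. \<integral>z. (h z)\<^sup>2 \<partial>(M1 \<Otimes>\<^sub>M M2)"
  define m where "m = Inf (?E ` ?K)"
  have bdd: "bdd_below (?E ` ?K)"
    by (rule bdd_belowI[of _ 0]) auto
  have m_le: "m \<le> ?E h" if "has_marginals M1 M2 h a b" for h
    unfolding m_def using bdd that by (intro cInf_lower) auto
  \<comment> \<open>The error is \<open>(1/4) ^ n\<close> because the L1 norm of a step is of the
    order of its square root, and \<open>(1/2) ^ n\<close> is summable.\<close>
  have "\<exists>h. has_marginals M1 M2 h a b \<and> ?E h < m + (1/4) ^ n" for n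
  proof -
    have "Inf (?E ` ?K) < m + (1/4) ^ n"
      by (simp add: m_def)
    then show ?thesis
      using assms bdd by (subst (asm) cInf_less_iff) auto
  qed
  then obtain g where g: "\<And>n. has_marginals M1 M2 (g n) a b" and gE: "\<And>n. ?E (g n) < m + (1/4) ^ n"
    by metis
  have gm[measurable]: "g n \<in> borel_measurable (M1 \<Otimes>\<^sub>M M2)"
    and gr: "g n \<in> space (M1 \<Otimes>\<^sub>M M2) \<rightarrow> {0..1}" for n
    using g by (auto simp: has_marginals_def)
  note [simp] = integrable_of_has_marginals[OF g]
  have [simp]: "integrable (M1 \<Otimes>\<^sub>M M2) (\<lambda>z. g n z * g k z)" for n k
    using g by (intro integrable_mult_of_has_marginals)
  have step: "(\<integral>z. \<bar>g (Suc n) z - g n z\<bar> \<partial>(M1 \<Otimes>\<^sub>M M2)) \<le> 5/2 * (1/2) ^ n" for n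
  proof -
    let ?h = "\<lambda>z. (1 - 1/2) * g n z + 1/2 * g (Suc n) z"
    have "has_marginals M1 M2 ?h a b"
      using has_marginals_convex[OF g[of n] g[of "Suc n"], of "1/2"] by simp
    then have "m \<le> ?E ?h"
      by (rule m_le)
    moreover have diff_eq: "(\<lambda>z. (g (Suc n) z - g n z)\<^sup>2)
        = (\<lambda>z. g (Suc n) z * g (Suc n) z - 2 * (g (Suc n) z * g n z) + g n z * g n z)"
      and mid_eq: "(\<lambda>z. (?h z)\<^sup>2)
        = (\<lambda>z. 1/4 * (g (Suc n) z * g (Suc n) z) + 1/2 * (g (Suc n) z * g n z) + 1/4 * (g n z * g n z))"
      by (simp_all add: fun_eq_iff power2_eq_square field_simps)
    \<comment> \<open>The parallelogram identity. With the midpoint energy bounded below by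
      \<open>m\<close>, the multiples of \<open>m\<close> cancel and four times the error
      remains.\<close>
    have "?E (\<lambda>z. g (Suc n) z - g n z) = 2 * ?E (g n) + 2 * ?E (g (Suc n)) - 4 * ?E ?h"
      unfolding diff_eq mid_eq by (simp add: power2_eq_square)
    moreover have "(1/4::real) ^ n / 4 \<le> (1/4) ^ n"
      by simp
    then have "?E (g n) < m + (1/4) ^ n" "?E (g (Suc n)) < m + (1/4) ^ n"
      using gE[of n] gE[of "Suc n"] unfolding power_Suc by linarith+
    ultimately have E: "?E (\<lambda>z. g (Suc n) z - g n z) \<le> 4 * (1/4) ^ n"
      by linarith
    have [simp]: "integrable (M1 \<Otimes>\<^sub>M M2) (\<lambda>z. (g (Suc n) z - g n z)\<^sup>2)"
      unfolding diff_eq by simp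
    \<comment> \<open>The inequality
      \<open>2 * \<bar>d\<bar> \<le> 2 ^ n * d\<^sup>2 + (1/2) ^ n\<close> turns the L2 bound into
      an L1 bound; the weight \<open>2 ^ n\<close> makes both terms of order
      \<open>(1/2) ^ n\<close> after integration.\<close>
    have "(\<integral>z. \<bar>g (Suc n) z - g n z\<bar> \<partial>(M1 \<Otimes>\<^sub>M M2))
        \<le> (\<integral>z. 1/2 * (2 ^ n * (g (Suc n) z - g n z)\<^sup>2 + (1/2) ^ n) \<partial>(M1 \<Otimes>\<^sub>M M2))"
    proof (rule integral_mono)
      fix z
      define d where "d = g (Suc n) z - g n z"
      have "0 \<le> (2 ^ n * \<bar>d\<bar> - 1)\<^sup>2 / 2 ^ n"
        by simp
      also have "(2 ^ n * \<bar>d\<bar> - 1)\<^sup>2 = 2 ^ n * (2 ^ n * d\<^sup>2 - 2 * \<bar>d\<bar>) + 1"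
        by (simp add: power2_diff power_mult_distrib) (simp add: power2_eq_square algebra_simps)
      also have "\<dots> / 2 ^ n = 2 ^ n * d\<^sup>2 - 2 * \<bar>d\<bar> + (1/2) ^ n"
        by (simp add: add_divide_distrib power_one_over)
      finally show "\<bar>g (Suc n) z - g n z\<bar> \<le> 1/2 * (2 ^ n * (g (Suc n) z - g n z)\<^sup>2 + (1/2) ^ n)"
        by (simp add: d_def)
    qed simp_all
    also have "\<dots> = 1/2 * (2 ^ n * ?E (\<lambda>z. g (Suc n) z - g n z) + (1/2) ^ n)"
      by (simp add: P.prob_space)
    also have "\<dots> \<le> 1/2 * (2 ^ n * (4 * (1/4) ^ n) + (1/2) ^ n)"
      using E by simp
    also have "\<dots> = 5/2 * (1/2) ^ n"
      by (simp add: field_simps flip: power_mult_distrib)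
    finally show ?thesis .
  qed
  have conv: "AE z in M1 \<Otimes>\<^sub>M M2. convergent (\<lambda>n. g n z)"
  proof (rule P.AE_convergent_if_summable_steps)
    show "summable (\<lambda>n. \<integral>z. \<bar>g (Suc n) z - g n z\<bar> \<partial>(M1 \<Otimes>\<^sub>M M2))"
      by (rule summable_comparison_test'[of "\<lambda>n. 5/2 * (1/2) ^ n" 0])
        (use step in \<open>auto intro!: summable_mult summable_geometric simp: integral_nonneg_AE\<close>)
  qed simp
  \<comment> \<open>\<open>lim\<close> is unspecified where the sequence diverges; clamping puts the
    values into \<open>{0..1}\<close> everywhere and leaves genuine limits unchanged.\<close>
  define f where "f z = max 0 (min 1 (lim (\<lambda>n. g n z)))" for z
  have [measurable]: "f \<in> borel_measurable (M1 \<Otimes>\<^sub>M M2)"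
    unfolding f_def by measurable
  have fr: "f \<in> space (M1 \<Otimes>\<^sub>M M2) \<rightarrow> {0..1}"
    by (auto simp: f_def)
  have lim: "AE z in M1 \<Otimes>\<^sub>M M2. (\<lambda>n. g n z) \<longlonglongrightarrow> f z"
    using conv AE_space
  proof eventually_elim
    case (elim z)
    then have l: "(\<lambda>n. g n z) \<longlonglongrightarrow> lim (\<lambda>n. g n z)"
      by (simp add: convergent_LIMSEQ_iff)
    have "0 \<le> lim (\<lambda>n. g n z)" "lim (\<lambda>n. g n z) \<le> 1"
      using gr elim by (auto intro!: LIMSEQ_le_const[OF l] LIMSEQ_le_const2[OF l] simp: Pi_iff)
    with l show ?case
      by (simp add: f_def)
  qed
  have fm: "has_marginals M1 M2 f a b"
    by (rule has_marginals_limit[OF g _ fr lim]) simp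
  have "(\<lambda>n. ?E (g n)) \<longlonglongrightarrow> ?E f"
  proof (rule integral_dominated_convergence[where w = "\<lambda>_. 1"])
    show "AE z in M1 \<Otimes>\<^sub>M M2. (\<lambda>n. (g n z)\<^sup>2) \<longlonglongrightarrow> (f z)\<^sup>2"
      using lim by eventually_elim (rule tendsto_power)
  qed (use gr in \<open>auto simp: Pi_iff power_le_one\<close>)
  moreover have "(\<lambda>n. m + (1/4) ^ n) \<longlonglongrightarrow> m + 0"
    by (intro tendsto_add tendsto_const LIMSEQ_power_zero) simp
  ultimately have "?E f \<le> m + 0"
    by (rule LIMSEQ_le) (use gE less_imp_le in blast)
  then show ?thesis
    using fm m_le unfolding minimal_energy_def by force
qed

text \<open>The segment from \<open>f\<close> to \<open>h\<close> consists of admissible functions,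
  so the one-sided derivative of the energy at \<open>f\<close> towards \<open>h\<close> is
  nonnegative. It is twice this integral.\<close>

lemma minimal_energy_variation:
  assumes f: "minimal_energy M1 M2 f a b" and h: "has_marginals M1 M2 h a b"
  shows "0 \<le> (\<integral>z. f z * (h z - f z) \<partial>(M1 \<Otimes>\<^sub>M M2))"
proof -
  let ?I = "\<lambda>h. \<integral>z. h z \<partial>(M1 \<Otimes>\<^sub>M M2)"
  have fm: "has_marginals M1 M2 f a b"
    using f by (simp add: minimal_energy_def)
  note [simp] = integrable_mult_of_has_marginals[OF fm fm] integrable_mult_of_has_marginals[OF fm h]
    integrable_mult_of_has_marginals[OF h fm] integrable_mult_of_has_marginals[OF h h]
  have sq_eq: "(\<lambda>z. (h z - f z)\<^sup>2) = (\<lambda>z. h z * h z - 2 * (f z * h z) + f z * f z)"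
    by (simp add: fun_eq_iff power2_eq_square algebra_simps)
  have [simp]: "integrable (M1 \<Otimes>\<^sub>M M2) (\<lambda>z. (h z - f z)\<^sup>2)"
    unfolding sq_eq by simp
  have [simp]: "integrable (M1 \<Otimes>\<^sub>M M2) (\<lambda>z. (f z)\<^sup>2)"
    by (simp add: power2_eq_square)
  have [simp]: "integrable (M1 \<Otimes>\<^sub>M M2) (\<lambda>z. f z * (h z - f z))"
    by (simp add: right_diff_distrib)
  define A where "A = ?I (\<lambda>z. f z * (h z - f z))"
  define B where "B = ?I (\<lambda>z. (h z - f z)\<^sup>2)"
  \<comment> \<open>The energy changes by \<open>u * (2 * A + u * B)\<close> along the segment;
    after division by \<open>u\<close> one can let \<open>u\<close> tend to 0.\<close>
  have key: "0 \<le> 2 * A + u * B" if "0 < u" "u \<le> 1" for u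
  proof -
    have "has_marginals M1 M2 (\<lambda>z. (1 - u) * f z + u * h z) a b"
      using has_marginals_convex[OF fm h, of u] that by (simp add: algebra_simps)
    then have "?I (\<lambda>z. (f z)\<^sup>2) \<le> ?I (\<lambda>z. ((1 - u) * f z + u * h z)\<^sup>2)"
      using f by (simp add: minimal_energy_def)
    also have "(\<lambda>z. ((1 - u) * f z + u * h z)\<^sup>2)
        = (\<lambda>z. (f z)\<^sup>2 + (2 * u * (f z * (h z - f z)) + u\<^sup>2 * (h z - f z)\<^sup>2))"
      by (simp add: fun_eq_iff power2_eq_square algebra_simps)
    also have "?I \<dots> = ?I (\<lambda>z. (f z)\<^sup>2) + (2 * u * A + u\<^sup>2 * B)"
      unfolding A_def B_def by simp
    finally have "0 \<le> u * (2 * A + u * B)"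
      by (simp add: power2_eq_square algebra_simps)
    with that show ?thesis
      by (simp add: zero_le_mult_iff)
  qed
  have "((\<lambda>u. 2 * A + u * B) \<longlongrightarrow> 2 * A + 0 * B) (at_right 0)"
    by (intro tendsto_intros)
  moreover have "eventually (\<lambda>u. 0 \<le> 2 * A + u * B) (at_right (0::real))"
    using key eventually_at_right_less[of 0] eventually_at_right_real[of 0 1]
    by (auto elim: eventually_mono)
  ultimately have "0 \<le> 2 * A + 0 * B"
    by (intro tendsto_lowerbound) auto
  then show ?thesis
    by (simp add: A_def)
qed

section \<open>Comparability of the columns of a minimizer\<close>

text \<open>Its vanishing means that column \<open>x\<close> lies almost everywhere below column
  \<open>x'\<close>; two columns are incomparable exactly when both excesses between them are
  positive.\<close>

definition excess :: "('a \<times> 'b \<Rightarrow> real) \<Rightarrow> 'a \<Rightarrow> 'a \<Rightarrow> real" where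
  "excess f x x' = (\<integral>y. max 0 (f (x, y) - f (x', y)) \<partial>M2)"

lemma excess_range:
  assumes "f \<in> borel_measurable (M1 \<Otimes>\<^sub>M M2)" "f \<in> space (M1 \<Otimes>\<^sub>M M2) \<rightarrow> {0..1}"
    and "x \<in> space M1" "x' \<in> space M1"
  shows "integrable M2 (\<lambda>y. max 0 (f (x, y) - f (x', y)))" "0 \<le> excess f x x'" "excess f x x' \<le> 1"
proof -
  show int: "integrable M2 (\<lambda>y. max 0 (f (x, y) - f (x', y)))"
    using assms by (intro integrable_max Bochner_Integration.integrable_diff integrable_section_fst) auto
  show "0 \<le> excess f x x'"
    unfolding excess_def by (rule integral_nonneg_AE) simp
  show "excess f x x' \<le> 1"
    unfolding excess_def
    by (rule M2.integral_le_const[OF int]) (use assms in \<open>auto simp: Pi_iff space_pair_measure intro!: AE_I2\<close>, smt (verit, best))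
qed

lemma measurable_excess [measurable (raw)]:
  assumes [measurable]: "f \<in> borel_measurable (M1 \<Otimes>\<^sub>M M2)" "g \<in> measurable K M1" "h \<in> measurable K M1"
  shows "(\<lambda>w. excess f (g w) (h w)) \<in> borel_measurable K"
  unfolding excess_def by measurable

text \<open>
The weights make the exchange antisymmetric in \<open>x\<close>, \<open>x'\<close> with zero integral over \<open>y\<close>, so that
subtracting its mean over \<open>x'\<close> from \<open>f\<close> preserves both marginals, whatever their order.
\<close>

definition exchange :: "('a \<times> 'b \<Rightarrow> real) \<Rightarrow> 'a \<Rightarrow> 'a \<Rightarrow> 'b \<Rightarrow> real" where
  "exchange f x x' y = excess f x' x * max 0 (f (x, y) - f (x', y))
     - excess f x x' * max 0 (f (x', y) - f (x, y))"

lemma measurable_exchange [measurable (raw)]: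
  assumes [measurable]: "f \<in> borel_measurable (M1 \<Otimes>\<^sub>M M2)" "g \<in> measurable K M1" "h \<in> measurable K M1"
    "k \<in> measurable K M2"
  shows "(\<lambda>w. exchange f (g w) (h w) (k w)) \<in> borel_measurable K"
  unfolding exchange_def by measurable

text \<open>Subtracting the mean exchange from \<open>f\<close> preserves the marginals, so the
  first-order condition makes the pairing of \<open>f\<close> with the mean exchange nonpositive. By
  antisymmetry twice this pairing is a triple integral of a nonnegative function, and its vanishing
  forces the product of the two excesses to be zero.\<close>

lemma minimal_energy_excess:
  assumes me: "minimal_energy M1 M2 f a b"
  shows "AE z in M1 \<Otimes>\<^sub>M M1. excess f (fst z) (snd z) = 0 \<or> excess f (snd z) (fst z) = 0"
proof -
  interpret D: pair_prob_space M1 M1 ..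
  interpret T: pair_prob_space "M1 \<Otimes>\<^sub>M M1" M2 ..
  have fm: "has_marginals M1 M2 f a b"
    using me by (simp add: minimal_energy_def)
  then have [measurable]: "f \<in> borel_measurable (M1 \<Otimes>\<^sub>M M2)"
    and fr: "f \<in> space (M1 \<Otimes>\<^sub>M M2) \<rightarrow> {0..1}"
    by (auto simp: has_marginals_def)
  have f01: "0 \<le> f (x, y)" "f (x, y) \<le> 1" if "x \<in> space M1" "y \<in> space M2" for x y
    using fr that by (auto simp: Pi_iff space_pair_measure)
  note exc = excess_range[OF \<open>f \<in> borel_measurable (M1 \<Otimes>\<^sub>M M2)\<close> fr]
  let ?V = "exchange f"
  have V_anti: "?V x' x y = - ?V x x' y" for x x' y
    by (simp add: exchange_def)
  \<comment> \<open>As the weights are at most 1, \<open>f (x, y) - ?V x x' y\<close> lies between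
    \<open>f (x, y)\<close> and \<open>f (x', y)\<close>. In \<open>V_D\<close> no mixed term
    arises, since the two positive parts are never both nonzero.\<close>
  have V_step: "0 \<le> f (x, y) - ?V x x' y" "f (x, y) - ?V x x' y \<le> 1" "\<bar>?V x x' y\<bar> \<le> 1"
    and V_D: "?V x x' y * (f (x, y) - f (x', y)) = excess f x' x * (max 0 (f (x, y) - f (x', y)))\<^sup>2
      + excess f x x' * (max 0 (f (x', y) - f (x, y)))\<^sup>2"
    if "x \<in> space M1" "x' \<in> space M1" "y \<in> space M2" for x x' y
  proof -
    have "0 \<le> excess f x' x * max 0 (f (x, y) - f (x', y))"
         "excess f x' x * max 0 (f (x, y) - f (x', y)) \<le> max 0 (f (x, y) - f (x', y))"
         "0 \<le> excess f x x' * max 0 (f (x', y) - f (x, y))"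
         "excess f x x' * max 0 (f (x', y) - f (x, y)) \<le> max 0 (f (x', y) - f (x, y))"
      using that exc by (auto intro!: mult_nonneg_nonneg mult_left_le_one_le)
    then show "0 \<le> f (x, y) - ?V x x' y" "f (x, y) - ?V x x' y \<le> 1" "\<bar>?V x x' y\<bar> \<le> 1"
      using f01[of x y] f01[of x' y] that unfolding exchange_def by linarith+
    show "?V x x' y * (f (x, y) - f (x', y)) = excess f x' x * (max 0 (f (x, y) - f (x', y)))\<^sup>2
      + excess f x x' * (max 0 (f (x', y) - f (x, y)))\<^sup>2"
      unfolding exchange_def by (auto simp: max_def power2_eq_square algebra_simps)
  qed
  \<comment> \<open>Each positive part integrates to one excess and carries the other as its weight,
    so the two products cancel.\<close>
  have V_int_y: "(\<integral>y. ?V x x' y \<partial>M2) = 0" if "x \<in> space M1" "x' \<in> space M1" for x x'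
    unfolding exchange_def using that exc by (simp flip: excess_def)
  have V_int_x': "integrable M1 (\<lambda>x'. ?V x x' y)" if "x \<in> space M1" "y \<in> space M2" for x y
    using that V_step by (intro M1.integrable_const_bound[where B = 1]) auto
  define G where "G z = (\<integral>x'. ?V (fst z) x' (snd z) \<partial>M1)" for z
  have [measurable]: "G \<in> borel_measurable (M1 \<Otimes>\<^sub>M M2)"
    unfolding G_def by measurable
  have h01: "0 \<le> f z - G z" "f z - G z \<le> 1" if z: "z \<in> space (M1 \<Otimes>\<^sub>M M2)" for z
  proof -
    obtain x y where z: "z = (x, y)" "x \<in> space M1" "y \<in> space M2"
      using z by (cases z) (simp add: space_pair_measure)
    \<comment> \<open>An average over \<open>x'\<close> of values in \<open>{0..1}\<close> stays in
      \<open>{0..1}\<close>.\<close>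
    have eq: "f z - G z = (\<integral>x'. f (x, y) - ?V x x' y \<partial>M1)"
      using z V_int_x' by (simp add: G_def M1.prob_space)
    show "0 \<le> f z - G z" "f z - G z \<le> 1"
      unfolding eq using z V_step
      by (intro M1.integral_ge_const M1.integral_le_const Bochner_Integration.integrable_diff V_int_x';
          auto)+
  qed
  have G_abs: "\<bar>G z\<bar> \<le> 1" if "z \<in> space (M1 \<Otimes>\<^sub>M M2)" for z
    using h01[OF that] fr that by (auto simp: Pi_iff abs_le_iff)
  have G_fst: "(\<integral>y. G (x, y) \<partial>M2) = 0" if x: "x \<in> space M1" for x
  proof -
    have "integrable (M1 \<Otimes>\<^sub>M M2) (case_prod (\<lambda>x' y. ?V x x' y))"
      using V_step x by (intro P.integrable_const_bound[where B = 1]) (auto simp: space_pair_measure)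
    from Fubini_integral[OF this] show ?thesis
      using x V_int_y by (simp add: G_def cong: Bochner_Integration.integral_cong)
  qed
  \<comment> \<open>After exchanging the order of integration, antisymmetry shows that the integral
    equals its own negative.\<close>
  have G_snd: "(\<integral>x. G (x, y) \<partial>M1) = 0" if y: "y \<in> space M2" for y
  proof -
    have "integrable (M1 \<Otimes>\<^sub>M M1) (case_prod (\<lambda>x x'. ?V x x' y))"
      using V_step y by (intro D.P.integrable_const_bound[where B = 1]) (auto simp: space_pair_measure)
    from D.Fubini_integral[OF this]
    have "(\<integral>x. G (x, y) \<partial>M1) = (\<integral>x'. \<integral>x. ?V x x' y \<partial>M1 \<partial>M1)"
      by (simp add: G_def)
    also have "\<dots> = (\<integral>x'. - G (x', y) \<partial>M1)"
      by (subst V_anti) (simp add: G_def)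
    finally show ?thesis
      by simp
  qed
  have "has_marginals M1 M2 (\<lambda>z. f z - G z) a b"
    unfolding has_marginals_def
  proof (intro conjI)
    have "integrable M2 (\<lambda>y. G (x, y))" if "x \<in> space M1" for x
      using G_abs that by (intro M2.integrable_const_bound[where B = 1]) (auto simp: space_pair_measure)
    moreover have "AE x in M1. a x = (\<integral>y. f (x, y) \<partial>M2)"
      using fm by (simp add: has_marginals_def)
    ultimately show "AE x in M1. a x = (\<integral>y. f (x, y) - G (x, y) \<partial>M2)"
      using AE_space by (auto elim!: eventually_elim2 simp: G_fst integrable_section_fst fr)
    have "integrable M1 (\<lambda>x. G (x, y))" if "y \<in> space M2" for y
      using G_abs that by (intro M1.integrable_const_bound[where B = 1]) (auto simp: space_pair_measure)
    moreover have "AE y in M2. b y = (\<integral>x. f (x, y) \<partial>M1)"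
      using fm by (simp add: has_marginals_def)
    ultimately show "AE y in M2. b y = (\<integral>x. f (x, y) - G (x, y) \<partial>M1)"
      using AE_space by (auto elim!: eventually_elim2 simp: G_snd integrable_section_snd fr)
  qed (use h01 in auto)
  from minimal_energy_variation[OF me this]
  have fG: "(\<integral>z. f z * G z \<partial>(M1 \<Otimes>\<^sub>M M2)) \<le> 0"
    by simp
  have prod_bound: "\<bar>f (x, y) * ?V x x' y\<bar> \<le> 1" "\<bar>f (x', y) * ?V x x' y\<bar> \<le> 1"
    if "x \<in> space M1" "x' \<in> space M1" "y \<in> space M2" for x x' y
    using that f01[of x y] f01[of x' y] V_step(3)[of x x' y]
    by (auto simp: abs_mult intro!: mult_le_one)
  \<comment> \<open>Interchanging \<open>x\<close> and \<open>x'\<close> turns the term with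
    \<open>f (x', y)\<close> into the negative of the term with \<open>f (x, y)\<close>, whence the
    factor 2.\<close>
  have J: "(\<integral>z. ?V (fst z) (snd z) y * (f (fst z, y) - f (snd z, y)) \<partial>(M1 \<Otimes>\<^sub>M M1))
      = 2 * (\<integral>x. f (x, y) * G (x, y) \<partial>M1)" if y: "y \<in> space M2" for y
  proof -
    let ?F = "\<lambda>z. f (fst z, y) * ?V (fst z) (snd z) y"
    let ?F' = "\<lambda>z. f (snd z, y) * ?V (fst z) (snd z) y"
    have i: "integrable (M1 \<Otimes>\<^sub>M M1) ?F" "integrable (M1 \<Otimes>\<^sub>M M1) ?F'"
      using prod_bound y
      by (auto intro!: D.P.integrable_const_bound[where B = 1] simp: space_pair_measure)
    have "integral\<^sup>L (M1 \<Otimes>\<^sub>M M1) ?F' = (\<integral>(x, x'). ?F' (x', x) \<partial>(M1 \<Otimes>\<^sub>M M1))"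
      using i by (intro D.integral_product_swap[symmetric]) auto
    also have "(\<lambda>(x, x'). ?F' (x', x)) = (\<lambda>z. - ?F z)"
    proof
      fix z :: "'a \<times> 'a"
      have "?V (snd z) (fst z) y = - ?V (fst z) (snd z) y"
        by (rule V_anti)
      then show "(case z of (x, x') \<Rightarrow> ?F' (x', x)) = - ?F z"
        by (simp add: case_prod_beta)
    qed
    finally have "integral\<^sup>L (M1 \<Otimes>\<^sub>M M1) ?F' = - integral\<^sup>L (M1 \<Otimes>\<^sub>M M1) ?F"
      by simp
    moreover have "integral\<^sup>L (M1 \<Otimes>\<^sub>M M1) ?F = (\<integral>x. f (x, y) * G (x, y) \<partial>M1)"
      using D.integral_fst'[OF i(1)] by (simp add: G_def)
    moreover have "(\<integral>z. ?V (fst z) (snd z) y * (f (fst z, y) - f (snd z, y)) \<partial>(M1 \<Otimes>\<^sub>M M1))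
      = (\<integral>z. ?F z - ?F' z \<partial>(M1 \<Otimes>\<^sub>M M1))"
      by (simp add: algebra_simps)
    ultimately show ?thesis
      using i by simp
  qed
  let ?W = "\<lambda>z y. ?V (fst z) (snd z) y * (f (fst z, y) - f (snd z, y))"
  have W_nonneg: "0 \<le> ?W z y" if "z \<in> space (M1 \<Otimes>\<^sub>M M1)" "y \<in> space M2" for z y
    using that exc by (subst V_D) (auto simp: space_pair_measure)
  have W_bound: "\<bar>?W z y\<bar> \<le> 2" if "z \<in> space (M1 \<Otimes>\<^sub>M M1)" "y \<in> space M2" for z y
    using that prod_bound[of "fst z" "snd z" y]
    by (auto simp: space_pair_measure right_diff_distrib abs_le_iff mult.commute)
  have W_int: "integrable ((M1 \<Otimes>\<^sub>M M1) \<Otimes>\<^sub>M M2) (case_prod ?W)"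
    using W_bound by (intro T.P.integrable_const_bound[where B = 2]) (auto simp: space_pair_measure)
  have "integrable (M1 \<Otimes>\<^sub>M M2) (\<lambda>z. f z * G z)"
    using fr G_abs by (intro P.integrable_const_bound[where B = 1])
      (auto simp: abs_mult Pi_iff intro!: mult_le_one AE_I2)
  from integral_snd[of "\<lambda>x y. f (x, y) * G (x, y)"] this
  have "(\<integral>y. \<integral>x. f (x, y) * G (x, y) \<partial>M1 \<partial>M2) \<le> 0"
    using fG by (simp add: case_prod_beta')
  then have "(\<integral>y. \<integral>z. ?W z y \<partial>(M1 \<Otimes>\<^sub>M M1) \<partial>M2) \<le> 0"
    by (simp add: J cong: Bochner_Integration.integral_cong)
  then have "(\<integral>z. \<integral>y. ?W z y \<partial>M2 \<partial>(M1 \<Otimes>\<^sub>M M1)) \<le> 0"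
    by (simp add: T.Fubini_integral[OF W_int])
  moreover have W_int_nonneg: "AE z in M1 \<Otimes>\<^sub>M M1. 0 \<le> (\<integral>y. ?W z y \<partial>M2)"
    using W_nonneg by (auto intro!: AE_I2 integral_nonneg_AE)
  ultimately have "(\<integral>z. \<integral>y. ?W z y \<partial>M2 \<partial>(M1 \<Otimes>\<^sub>M M1)) = 0"
    using integral_nonneg_AE[OF W_int_nonneg] by linarith
  then have "AE z in M1 \<Otimes>\<^sub>M M1. (\<integral>y. ?W z y \<partial>M2) = 0"
    using integral_nonneg_eq_0_iff_AE[OF T.integrable_fst[OF W_int] W_int_nonneg] by simp
  then show ?thesis
    using AE_space
  proof eventually_elim
    case (elim z)
    obtain x x' where z: "z = (x, x')" "x \<in> space M1" "x' \<in> space M1"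
      using elim(2) by (auto simp: space_pair_measure)
    have "integrable M2 (?W z)"
      using W_bound elim(2) z by (intro M2.integrable_const_bound[where B = 2]) auto
    moreover have "AE y in M2. 0 \<le> ?W z y"
      using W_nonneg elim(2) by (auto intro!: AE_I2)
    ultimately have "AE y in M2. ?W z y = 0"
      using integral_nonneg_eq_0_iff_AE elim(1) by blast
    then have "AE y in M2. excess f x' x * max 0 (f (x, y) - f (x', y)) = 0"
      using AE_space
    proof eventually_elim
      case (elim y)
      have "0 \<le> excess f x' x * (max 0 (f (x, y) - f (x', y)))\<^sup>2"
        "0 \<le> excess f x x' * (max 0 (f (x', y) - f (x, y)))\<^sup>2"
        using z exc by auto
      moreover have "excess f x' x * (max 0 (f (x, y) - f (x', y)))\<^sup>2
          + excess f x x' * (max 0 (f (x', y) - f (x, y)))\<^sup>2 = 0"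
        using elim V_D[of x x' y] z by (metis fst_conv snd_conv)
      ultimately have "excess f x' x * (max 0 (f (x, y) - f (x', y)))\<^sup>2 = 0"
        by linarith
      then show ?case
        by simp
    qed
    \<comment> \<open>The weight does not depend on \<open>y\<close>, so this integral is the
      product of the two excesses.\<close>
    then have "(\<integral>y. excess f x' x * max 0 (f (x, y) - f (x', y)) \<partial>M2) = 0"
      by (rule integral_eq_zero_AE)
    then show ?case
      using z by (auto simp: excess_def)
  qed
qed

text \<open>The two excesses differ by \<open>a x - a x'\<close>, and for almost every pair one of
  them is zero. If \<open>a x \<le> a x'\<close>, nonnegativity then leaves only
  \<open>excess f x x' = 0\<close>.\<close>

lemma minimal_energy_mono:
  assumes me: "minimal_energy M1 M2 f a b"
  shows "AE z in M1 \<Otimes>\<^sub>M M1. a (fst z) \<le> a (snd z) \<longrightarrow> (AE y in M2. f (fst z, y) \<le> f (snd z, y))"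
proof -
  interpret D: pair_prob_space M1 M1 ..
  have fm: "f \<in> borel_measurable (M1 \<Otimes>\<^sub>M M2)" "f \<in> space (M1 \<Otimes>\<^sub>M M2) \<rightarrow> {0..1}"
    and ae: "AE x in M1. a x = (\<integral>y. f (x, y) \<partial>M2)"
    using me by (auto simp: has_marginals_def minimal_energy_def)
  note exc = excess_range[OF fm]
  show ?thesis
    using minimal_energy_excess[OF me] D.AE_fst[OF ae] D.AE_snd[OF ae] AE_space
  proof eventually_elim
    case (elim z)
    obtain x x' where z: "z = (x, x')" "x \<in> space M1" "x' \<in> space M1"
      using elim(4) by (auto simp: space_pair_measure)
    note int = integrable_section_fst[OF fm]
    have "excess f x x' - excess f x' x
        = (\<integral>y. max 0 (f (x, y) - f (x', y)) - max 0 (f (x', y) - f (x, y)) \<partial>M2)"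
      unfolding excess_def using z exc by simp
    also have "\<dots> = (\<integral>y. f (x, y) - f (x', y) \<partial>M2)"
      by (rule Bochner_Integration.integral_cong) (auto simp: max_def)
    also have "\<dots> = a x - a x'"
      using z int elim(2,3) by simp
    finally have diff: "excess f x x' - excess f x' x = a x - a x'" .
    show ?case
    proof
      assume "a (fst z) \<le> a (snd z)"
      then have "excess f x x' = 0"
        using diff z elim(1) exc(2)[OF z(2,3)] exc(2)[OF z(3,2)] by auto
      then have "AE y in M2. max 0 (f (x, y) - f (x', y)) = 0"
        using integral_nonneg_eq_0_iff_AE[OF exc(1)[OF z(2,3)]] by (simp add: excess_def)
      then show "AE y in M2. f (fst z, y) \<le> f (snd z, y)"
        by eventually_elim (auto simp: z max_def split: if_splits)
    qed
  qed
qed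

end

subsection \<open>The unit interval\<close>

text \<open>Preimages under \<open>f\<close> and \<open>g\<close> differ by a subset of a null set,
  which is measurable by completeness.\<close>

lemma (in complete_measure) measurable_AE_cong:
  assumes f: "f \<in> measurable M N" and g: "g \<in> space M \<rightarrow> space N" and eq: "AE x in M. f x = g x"
  shows "g \<in> measurable M N"
proof (rule measurableI)
  fix A assume A: "A \<in> sets N"
  have "AE x in M. x \<in> f -` A \<inter> space M \<longleftrightarrow> x \<in> g -` A \<inter> space M"
    using eq by eventually_elim auto
  then show "g -` A \<inter> space M \<in> sets M"
    by (rule in_sets_AE) (use f A in auto)
qed (use g in auto)

text \<open>Borel sets are used because a product of completed measures is in general not complete,
  whereas here the product is again Lebesgue measure on the Borel subsets of the square, with all
  sections measurable.\<close>

abbreviation unit_interval :: "real measure" ("\<I>") where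
  "\<I> \<equiv> restrict_space lborel {0..1}"

lemma emeasure_unit_interval:
  assumes "A \<in> sets borel" "A \<subseteq> {0..1}"
  shows "emeasure \<I> A = emeasure lborel A"
  using assms by (simp add: emeasure_restrict_space)

lemma prob_space_unit_interval: "prob_space \<I>"
  by (rule prob_spaceI) (simp add: emeasure_restrict_space)

interpretation I: prob_space \<I>
  by (rule prob_space_unit_interval)

interpretation II: pair_prob_space \<I> \<I> ..

lemma unit_square_borel [measurable]: "unit_square \<in> sets borel"
  by (intro borel_closed closed_Times) simp_all

text \<open>The sigma-algebras agree because the identity is measurable in both directions; after
  that it suffices to compare the measures on rectangles.\<close>

lemma pair_unit_interval: "\<I> \<Otimes>\<^sub>M \<I> = restrict_space lborel unit_square"
proof (rule pair_measure_eqI)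
  show "sigma_finite_measure \<I>" ..
  show "sigma_finite_measure \<I>" ..
  show sets_eq: "sets (\<I> \<Otimes>\<^sub>M \<I>) = sets (restrict_space lborel unit_square)"
  proof -
    let ?R = "restrict_space (lborel \<Otimes>\<^sub>M lborel) unit_square :: (real \<times> real) measure"
    have spaces: "space (\<I> \<Otimes>\<^sub>M \<I>) = unit_square" "space ?R = unit_square"
      by (simp_all add: space_pair_measure space_restrict_space)
    have "fst \<in> measurable ?R \<I>" "snd \<in> measurable ?R \<I>"
      by (rule measurable_restrict_space2;
          (rule measurable_restrict_space1)?; auto simp: space_restrict_space space_pair_measure)+
    then have to_pair: "(\<lambda>z. z) \<in> measurable ?R (\<I> \<Otimes>\<^sub>M \<I>)"
      by (intro measurable_pair) (simp_all add: comp_def)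
    have from_pair: "(\<lambda>z. z) \<in> measurable (\<I> \<Otimes>\<^sub>M \<I>) ?R"
    proof (rule measurable_restrict_space2)
      have "(\<lambda>x. x) \<in> measurable \<I> lborel"
        by (rule measurable_restrict_space1) simp
      then show "(\<lambda>z. z) \<in> measurable (\<I> \<Otimes>\<^sub>M \<I>) (lborel \<Otimes>\<^sub>M lborel)"
        by (intro measurable_pair)
          (auto simp: comp_def intro: measurable_compose[OF measurable_fst] measurable_compose[OF measurable_snd])
    qed (auto simp: space_pair_measure)
    have "sets (\<I> \<Otimes>\<^sub>M \<I>) = sets ?R"
    proof (intro equalityI subsetI)
      fix S assume S: "S \<in> sets (\<I> \<Otimes>\<^sub>M \<I>)"
      then have "(\<lambda>z. z) -` S \<inter> space ?R = S"
        using sets.sets_into_space[OF S] unfolding spaces by (simp add: Int_absorb2)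
      then show "S \<in> sets ?R"
        using measurable_sets[OF to_pair S] by (simp only:)
    next
      fix S assume S: "S \<in> sets ?R"
      then have "(\<lambda>z. z) -` S \<inter> space (\<I> \<Otimes>\<^sub>M \<I>) = S"
        using sets.sets_into_space[OF S] unfolding spaces by (simp add: Int_absorb2)
      then show "S \<in> sets (\<I> \<Otimes>\<^sub>M \<I>)"
        using measurable_sets[OF from_pair S] by (simp only:)
    qed
    then show ?thesis
      by (simp add: lborel_prod)
  qed
  fix A B assume AB: "A \<in> sets \<I>" "B \<in> sets \<I>"
  then have *: "A \<in> sets borel" "A \<subseteq> {0..1}" "B \<in> sets borel" "B \<subseteq> {0..1}"
    by (auto simp: sets_restrict_space)
  have "emeasure lborel (A \<times> B) = emeasure lborel A * emeasure lborel B"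
    using lborel.emeasure_pair_measure_Times[of A lborel B] * by (simp add: lborel_prod)
  moreover have "A \<times> B \<subseteq> unit_square"
    using * by blast
  ultimately show "emeasure \<I> A * emeasure \<I> B = emeasure (restrict_space lborel unit_square) (A \<times> B)"
    using * unit_square_borel by (simp add: emeasure_restrict_space)
qed

lemma AE_lebesgue_on_unit_interval: "(AE x in lebesgue_on {0..1}. Q x) \<longleftrightarrow> (AE x in \<I>. Q x)"
  by (simp add: AE_restrict_space_iff AE_completion_iff)

lemma AE_lebesgue_on_unit_square: "(AE z in lebesgue_on unit_square. Q z) \<longleftrightarrow> (AE z in \<I> \<Otimes>\<^sub>M \<I>. Q z)"
  unfolding pair_unit_interval using unit_square_borel
  by (simp add: AE_restrict_space_iff AE_completion_iff)

text \<open>Completeness transfers measurability from \<open>g\<close> to \<open>f\<close>. This is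
  applied to sections of a Lebesgue measurable function that has a Borel version.\<close>

lemma lebesgue_integral_unit_interval_cong_AE:
  fixes f g :: "real \<Rightarrow> real"
  assumes g: "g \<in> borel_measurable \<I>" and eq: "AE x in \<I>. f x = g x"
  shows "(LINT x|lebesgue_on {0..1}. f x) = (LINT x|\<I>. g x)"
proof -
  let ?f = "\<lambda>x. indicator {0..1} x *\<^sub>R f x" and ?g = "\<lambda>x. indicator {0..1} x *\<^sub>R g x"
  have gm: "?g \<in> borel_measurable lborel"
    using g by (simp add: borel_measurable_restrict_space_iff)
  then have gm': "?g \<in> borel_measurable lebesgue"
    by (rule measurable_completion)
  have "AE x in lebesgue. x \<in> {0..1} \<longrightarrow> f x = g x"
    using eq by (simp add: AE_restrict_space_iff AE_completion_iff)
  then have ae: "AE x in lebesgue. ?g x = ?f x"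
    by eventually_elim (auto simp: indicator_def)
  have fm: "?f \<in> borel_measurable lebesgue"
    by (rule completion.measurable_AE_cong[OF gm' _ ae]) simp
  have "(LINT x|lebesgue_on {0..1}. f x) = (LINT x|lebesgue. ?f x)"
    by (rule integral_restrict_space) simp
  also have "\<dots> = (LINT x|lebesgue. ?g x)"
    using ae by (intro integral_cong_AE fm gm') auto
  also have "\<dots> = (LINT x|lborel. ?g x)"
    by (rule integral_completion[OF gm])
  also have "\<dots> = (LINT x|\<I>. g x)"
    by (rule integral_restrict_space[symmetric]) simp
  finally show ?thesis .
qed

text \<open>The bridge between the two notions: by Fubini almost every section of \<open>f\<close>
  agrees almost everywhere with that of \<open>g\<close>, so their integrals coincide, and
  \<open>f\<close> inherits Lebesgue measurability from \<open>g\<close>.\<close>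

lemma rationalizes_cong_AE:
  assumes g: "g \<in> borel_measurable (\<I> \<Otimes>\<^sub>M \<I>)" "g \<in> unit_square \<rightarrow> {0..1}"
    and f: "f \<in> unit_square \<rightarrow> {0..1}"
    and eq: "AE z in \<I> \<Otimes>\<^sub>M \<I>. f z = g z"
  shows "rationalizes f q \<longleftrightarrow> has_marginals \<I> \<I> g (fst q) (snd q)"
proof -
  have fst_eq: "AE x in \<I>. (LINT y|lebesgue_on {0..1}. f (x, y)) = (LINT y|\<I>. g (x, y))"
    using II.AE_pair[OF eq] AE_space
    by eventually_elim (rule lebesgue_integral_unit_interval_cong_AE, use g in auto)
  have snd_eq: "AE y in \<I>. (LINT x|lebesgue_on {0..1}. f (x, y)) = (LINT x|\<I>. g (x, y))"
    using II.AE_pair_snd[OF eq] AE_space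
    by eventually_elim (rule lebesgue_integral_unit_interval_cong_AE, use g in auto)
  note sq = unit_square_borel
  let ?f = "\<lambda>x. indicator unit_square x *\<^sub>R f x" and ?g = "\<lambda>x. indicator unit_square x *\<^sub>R g x"
  have "?g \<in> borel_measurable lborel"
    using g sq unfolding pair_unit_interval by (simp add: borel_measurable_restrict_space_iff)
  then have gm: "?g \<in> borel_measurable lebesgue"
    by (rule measurable_completion)
  have "AE z in lebesgue. z \<in> unit_square \<longrightarrow> f z = g z"
    using eq sq unfolding pair_unit_interval by (simp add: AE_restrict_space_iff AE_completion_iff)
  then have ae: "AE z in lebesgue. ?g z = ?f z"
    by eventually_elim (auto simp: indicator_def)
  have "?f \<in> borel_measurable lebesgue"
    by (rule completion.measurable_AE_cong[OF gm _ ae]) simp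
  then have "f \<in> borel_measurable (lebesgue_on unit_square)"
    using sq by (simp add: borel_measurable_restrict_space_iff)
  moreover have "(AE x in \<I>. fst q x = (LINT y|lebesgue_on {0..1}. f (x, y)))
      \<longleftrightarrow> (AE x in \<I>. fst q x = (LINT y|\<I>. g (x, y)))"
    using fst_eq by (auto elim: eventually_elim2)
  moreover have "(AE y in \<I>. snd q y = (LINT x|lebesgue_on {0..1}. f (x, y)))
      \<longleftrightarrow> (AE y in \<I>. snd q y = (LINT x|\<I>. g (x, y)))"
    using snd_eq by (auto elim: eventually_elim2)
  ultimately show ?thesis
    using f g by (auto simp: rationalizes_def has_marginals_def AE_lebesgue_on_unit_interval space_pair_measure)
qed

lemma ex_borel_version:
  assumes f: "f \<in> borel_measurable (lebesgue_on unit_square)" "f \<in> unit_square \<rightarrow> {0..1::real}"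
  shows "\<exists>g. g \<in> borel_measurable (\<I> \<Otimes>\<^sub>M \<I>) \<and> g \<in> unit_square \<rightarrow> {0..1} \<and> (AE z in \<I> \<Otimes>\<^sub>M \<I>. f z = g z)"
proof -
  note sq = unit_square_borel
  have "(\<lambda>z. indicator unit_square z *\<^sub>R f z) \<in> borel_measurable lebesgue"
    using f(1) sq by (simp add: borel_measurable_restrict_space_iff)
  from completion_ex_borel_measurable_real[OF this]
  obtain g where g: "g \<in> borel_measurable lborel" and ae: "AE z in lborel. indicator unit_square z *\<^sub>R f z = g z"
    by blast
  \<comment> \<open>The Borel version may leave \<open>{0..1}\<close> on a null set; clamping
    repairs this.\<close>
  have "(\<lambda>z. max 0 (min 1 (g z))) \<in> borel_measurable (\<I> \<Otimes>\<^sub>M \<I>)"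
    unfolding pair_unit_interval using g by (intro measurable_restrict_space1) simp
  moreover have "AE z in \<I> \<Otimes>\<^sub>M \<I>. f z = max 0 (min 1 (g z))"
  proof -
    have "AE z in lborel. z \<in> unit_square \<longrightarrow> f z = max 0 (min 1 (g z))"
      using ae
    proof eventually_elim
      case (elim z)
      show ?case
      proof
        assume z: "z \<in> unit_square"
        then have "g z = f z" "f z \<in> {0..1}"
          using elim funcset_mem[OF f(2), of z] by simp_all
        then show "f z = max 0 (min 1 (g z))"
          by auto
      qed
    qed
    then show ?thesis
      unfolding pair_unit_interval using sq by (simp add: AE_restrict_space_iff)
  qed
  ultimately show ?thesis
    by (intro exI[of _ "\<lambda>z. max 0 (min 1 (g z))"]) auto
qed

lemma rationalizes_borel:
  assumes "rationalizes f q"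
  shows "\<exists>g. has_marginals \<I> \<I> g (fst q) (snd q) \<and> (AE z in \<I> \<Otimes>\<^sub>M \<I>. f z = g z)"
  using assms ex_borel_version[of f] rationalizes_cong_AE[of _ f q]
  by (auto simp: rationalizes_def)

lemma rationalizes_of_has_marginals:
  assumes "has_marginals \<I> \<I> g a b"
  shows "rationalizes g (a, b)"
  using assms rationalizes_cong_AE[of g g "(a, b)"]
  by (auto simp: has_marginals_def space_pair_measure)

section \<open>Functions that are monotone up to null sets\<close>

text \<open>\<open>E\<close> collects the points that compare correctly with almost every other
  point. If \<open>t < x\<close> in \<open>E\<close>, almost every \<open>z\<close> between them
  satisfies \<open>p t \<le> p z \<le> p x\<close>, and such \<open>z\<close> exist because the
  interval has positive length.\<close>

lemma ex_mono_on_conull: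
  fixes p :: "real \<Rightarrow> real"
  assumes "AE z in \<I> \<Otimes>\<^sub>M \<I>. fst z < snd z \<longrightarrow> p (fst z) \<le> p (snd z)"
  shows "\<exists>E \<subseteq> {0..1}. (AE x in \<I>. x \<in> E) \<and> mono_on E p"
proof (intro exI conjI)
  let ?E = "{x \<in> {0..1}. (AE z in \<I>. x < z \<longrightarrow> p x \<le> p z) \<and> (AE z in \<I>. z < x \<longrightarrow> p z \<le> p x)}"
  show "AE x in \<I>. x \<in> ?E"
    using II.AE_pair[OF assms] II.AE_pair_snd[OF assms] AE_space by eventually_elim auto
  show "mono_on ?E p"
  proof (rule mono_onI, rule ccontr)
    fix t x assume tx: "t \<in> ?E" "x \<in> ?E" "t \<le> x" and less: "\<not> p t \<le> p x"
    then have "t < x"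
      by (cases "t = x") auto
    have "AE z in \<I>. t < z \<longrightarrow> p t \<le> p z" "AE z in \<I>. z < x \<longrightarrow> p z \<le> p x"
      using tx by auto
    then have "AE z in \<I>. z \<notin> {t<..<x}"
      by eventually_elim (use less in auto)
    then have "emeasure \<I> {t<..<x} = 0"
      using tx by (subst (asm) AE_iff_measurable[OF _ refl])
        (auto simp: sets_restrict_space_iff intro!: arg_cong[where f = "emeasure _"] elim!: trans[rotated])
    moreover have "emeasure \<I> {t<..<x} = ennreal (x - t)"
      using tx by (subst emeasure_unit_interval) auto
    ultimately show False
      using \<open>t < x\<close> by simp
  qed
qed auto

text \<open>The supremum of \<open>p\<close> over the good points strictly to the left of
  \<open>x\<close> is monotone and left-continuous. It agrees with \<open>p\<close> at every good
  point where it is continuous, hence almost everywhere.\<close>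

lemma ex_monotone_lc_version:
  fixes p :: "real \<Rightarrow> real"
  assumes range: "p \<in> {0..1} \<rightarrow> {0..1}"
    and mono: "AE z in \<I> \<Otimes>\<^sub>M \<I>. fst z < snd z \<longrightarrow> p (fst z) \<le> p (snd z)"
  shows "\<exists>P. monotone_lc P \<and> (AE x in \<I>. P x = p x)"
proof -
  obtain E where E: "E \<subseteq> {0..1}" "AE x in \<I>. x \<in> E" and mono_E: "mono_on E p"
    using ex_mono_on_conull[OF mono] by blast
  have p01: "0 \<le> p t" "p t \<le> 1" if "t \<in> E" for t
    using range E(1) that by (auto simp: Pi_iff)
  \<comment> \<open>The inserted 0 is a lower bound for the values and makes the supremum meaningful
    where no good point lies to the left; the strict bound \<open>{..<x}\<close> yields
    left-continuity.\<close>
  define S where "S x = insert 0 (p ` (E \<inter> {..<x}))" for x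
  define P where "P x = Sup (S x)" for x
  have S01: "S x \<subseteq> {0..1}" for x
    using p01 by (auto simp: S_def)
  then have bdd: "bdd_above (S x)" for x
    by (meson bdd_above_Icc bdd_above_mono)
  have S_ne: "S x \<noteq> {}" for x
    by (simp add: S_def)
  have upper: "p t \<le> P x" if "t \<in> E" "t < x" for t x
    unfolding P_def by (rule cSup_upper) (use that bdd in \<open>auto simp: S_def\<close>)
  have P0: "0 \<le> P x" for x
    unfolding P_def by (rule cSup_upper) (use bdd in \<open>auto simp: S_def\<close>)
  have P1: "P x \<le> 1" for x
    unfolding P_def by (rule cSup_least[OF S_ne]) (use S01[of x] in \<open>auto dest: subsetD\<close>)
  have mono_P: "mono P"
    unfolding P_def by (intro monoI cSup_subset_mono S_ne bdd) (auto simp: S_def)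
  have lc: "continuous (at_left x) P" for x
    unfolding continuous_within
  proof (rule order_tendstoI)
    fix a assume "a < P x"
    then obtain s where s: "s \<in> S x" "a < s"
      unfolding P_def using less_cSup_iff[OF S_ne bdd] by auto
    show "eventually (\<lambda>y. a < P y) (at x within {..<x})"
    proof (cases "s = 0")
      case True
      with s(2) have "a < P y" for y
        using P0[of y] by linarith
      then show ?thesis
        by simp
    next
      case False
      then obtain t where t: "t \<in> E" "t < x" "s = p t"
        using s(1) by (auto simp: S_def)
      have "eventually (\<lambda>y. y \<in> {t<..<x}) (at_left x)"
        using t(2) by (rule eventually_at_left_real)
      then show ?thesis
        by eventually_elim (use t s(2) upper in \<open>auto intro: less_le_trans\<close>)
    qed
  next
    fix a assume a: "P x < a"
    have "eventually (\<lambda>y. y < x) (at_left x)"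
      by (simp add: eventually_at_filter)
    then show "eventually (\<lambda>y. P y < a) (at x within {..<x})"
      by eventually_elim (rule le_less_trans[OF monoD[OF mono_P less_imp_le] a])
  qed
  have "{x. \<not> isCont P x} \<in> null_sets lborel"
    by (intro countable_imp_null_set_lborel mono_ctble_discont mono_P)
  then have "AE x in lborel. isCont P x"
    by (auto dest: AE_not_in)
  then have "AE x in \<I>. isCont P x"
    by (simp add: AE_restrict_space_iff eventually_mono)
  with E(2) have "AE x in \<I>. P x = p x"
  proof eventually_elim
    case (elim x)
    \<comment> \<open>Monotonicity on \<open>E\<close> bounds \<open>P x\<close> by
      \<open>p x\<close>. Conversely \<open>p x \<le> P y\<close> for all \<open>y > x\<close>, and
      continuity lets \<open>y\<close> decrease to \<open>x\<close>.\<close>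
    have "P x \<le> p x"
      unfolding P_def
      by (rule cSup_least[OF S_ne]) (use elim p01 mono_E in \<open>auto simp: S_def dest: mono_onD\<close>)
    moreover have "(P \<longlongrightarrow> P x) (at_right x)"
      using elim by (simp add: isCont_def filterlim_at_split)
    then have "p x \<le> P x"
    proof (rule tendsto_lowerbound)
      have "eventually (\<lambda>y. x < y) (at_right x)"
        by (simp add: eventually_at_filter)
      then show "eventually (\<lambda>y. p x \<le> P y) (at_right x)"
        by eventually_elim (rule upper[OF elim(1)])
    qed simp
    ultimately show ?case
      by simp
  qed
  moreover have "monotone_lc P"
    using P0 P1 lc mono_P by (auto simp: monotone_lc_def mono_on_def mono_def)
  ultimately show ?thesis
    by blast
qed

text \<open>Such a function is the indicator of a final segment, whose length is the integral. At a
  good point \<open>y\<close> with value 1 the function dominates the indicator of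
  \<open>{y..1}\<close>, with value 0 it is dominated by it; integration compares \<open>y\<close>
  with \<open>1 - ?c\<close>.\<close>

lemma ae_mono_indicator:
  fixes p :: "real \<Rightarrow> real"
  assumes p[measurable]: "p \<in> borel_measurable \<I>"
    and mono: "AE z in \<I> \<Otimes>\<^sub>M \<I>. fst z < snd z \<longrightarrow> p (fst z) \<le> p (snd z)"
    and two: "AE y in \<I>. p y = 0 \<or> p y = 1"
  shows "AE y in \<I>. p y = (if 1 - (\<integral>t. p t \<partial>\<I>) \<le> y then 1 else 0)"
proof -
  let ?c = "\<integral>t. p t \<partial>\<I>"
  obtain E where E: "E \<subseteq> {0..1}" "AE x in \<I>. x \<in> E" and mono_E: "mono_on E p"
    using ex_mono_on_conull[OF mono] by blast
  have int: "integrable \<I> p"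
    by (rule I.integrable_const_bound[where B = 1]) (use two in \<open>auto elim: eventually_mono\<close>)
  have ind: "integrable \<I> (indicator {y..1} :: real \<Rightarrow> real)"
    "(\<integral>t. indicator {y..1} t \<partial>\<I>) = 1 - y" if "y \<in> {0..1}" for y
  proof -
    have *: "{y..1} \<in> sets \<I>"
      using that by (auto simp: sets_restrict_space_iff)
    then show "integrable \<I> (indicator {y..1} :: real \<Rightarrow> real)"
      by (simp add: integrable_real_indicator emeasure_unit_interval I.emeasure_eq_measure)
    have "measure \<I> {y..1} = 1 - y"
      using that by (simp add: measure_def emeasure_restrict_space)
    then show "(\<integral>t. indicator {y..1} t \<partial>\<I>) = 1 - y"
      using that by (simp add: Int_absorb2)
  qed
  \<comment> \<open>The value 0 only yields \<open>y \<le> 1 - ?c\<close>, so the boundary point has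
    to be discarded.\<close>
  have singleton: "AE y in \<I>. y \<noteq> c" for c
    using AE_lborel_singleton[of c] by (simp add: AE_restrict_space_iff eventually_mono)
  show ?thesis
    using E(2) two singleton[of "1 - ?c"]
  proof eventually_elim
    case (elim y)
    have y01: "y \<in> {0..1}"
      using elim(1) E(1) by blast
    show ?case
    proof (cases "p y = 1")
      case True
      have "AE t in \<I>. indicator {y..1} t \<le> p t"
        using E(2) two
        by eventually_elim (use True elim(1) mono_onD[OF mono_E, of y] in \<open>fastforce simp: indicator_def\<close>)
      then have "1 - y \<le> ?c"
        using integral_mono_AE[OF ind(1)[OF y01] int] ind(2)[OF y01] by simp
      with True show ?thesis
        by simp
    next
      case False
      have "AE t in \<I>. p t \<le> indicator {y..1} t"
        using E(2) two AE_space
        by eventually_elim (use False elim(1,2) mono_onD[OF mono_E, of _ y] in \<open>fastforce simp: indicator_def\<close>)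
      then have "?c \<le> 1 - y"
        using integral_mono_AE[OF int ind(1)[OF y01]] ind(2)[OF y01] by simp
      with False elim(2,3) show ?thesis
        by auto
    qed
  qed
qed

subsection \<open>Up-sets and extreme points\<close>

text \<open>\<open>(\<phi> x + \<psi> y) * (f (x, y) - h (x, y))\<close> is nonnegative, as
  \<open>f\<close> takes the extreme value matching the sign of the first factor. Its integral is
  zero, since each summand depends on one coordinate and \<open>f\<close>, \<open>h\<close> have
  equal marginals.\<close>

lemma (in pair_prob_space) threshold_rationalization_unique:
  fixes \<phi> :: "'a \<Rightarrow> real" and \<psi> :: "'b \<Rightarrow> real"
  assumes f: "has_marginals M1 M2 f a b" and h: "has_marginals M1 M2 h a b"
    and \<phi>[measurable]: "\<phi> \<in> borel_measurable M1" and \<phi>_bound: "\<And>x. x \<in> space M1 \<Longrightarrow> \<bar>\<phi> x\<bar> \<le> c"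
    and \<psi>[measurable]: "\<psi> \<in> borel_measurable M2" and \<psi>_bound: "\<And>y. y \<in> space M2 \<Longrightarrow> \<bar>\<psi> y\<bar> \<le> c"
    and f1: "\<And>x y. x \<in> space M1 \<Longrightarrow> y \<in> space M2 \<Longrightarrow> 0 < \<phi> x + \<psi> y \<Longrightarrow> f (x, y) = 1"
    and f0: "\<And>x y. x \<in> space M1 \<Longrightarrow> y \<in> space M2 \<Longrightarrow> \<phi> x + \<psi> y < 0 \<Longrightarrow> f (x, y) = 0"
    and nz: "AE z in M1 \<Otimes>\<^sub>M M2. \<phi> (fst z) + \<psi> (snd z) \<noteq> 0"
  shows "AE z in M1 \<Otimes>\<^sub>M M2. h z = f z"
proof -
  have [measurable]: "f \<in> borel_measurable (M1 \<Otimes>\<^sub>M M2)" "h \<in> borel_measurable (M1 \<Otimes>\<^sub>M M2)"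
    and fr: "f \<in> space (M1 \<Otimes>\<^sub>M M2) \<rightarrow> {0..1}" and hr: "h \<in> space (M1 \<Otimes>\<^sub>M M2) \<rightarrow> {0..1}"
    and ae: "AE x in M1. a x = (\<integral>y. f (x, y) \<partial>M2)" "AE x in M1. a x = (\<integral>y. h (x, y) \<partial>M2)"
       "AE y in M2. b y = (\<integral>x. f (x, y) \<partial>M1)" "AE y in M2. b y = (\<integral>x. h (x, y) \<partial>M1)"
    using f h by (auto simp: has_marginals_def)
  define d where "d z = f z - h z" for z
  have [measurable]: "d \<in> borel_measurable (M1 \<Otimes>\<^sub>M M2)"
    unfolding d_def by measurable
  have d_bound: "\<bar>d z\<bar> \<le> 1" if "z \<in> space (M1 \<Otimes>\<^sub>M M2)" for z
    using funcset_mem[OF fr that] funcset_mem[OF hr that] by (auto simp: d_def)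
  have prod_bound: "\<bar>s * d z\<bar> \<le> c" if "\<bar>s\<bar> \<le> c" "z \<in> space (M1 \<Otimes>\<^sub>M M2)" for s z
    using mult_mono'[OF that(1) d_bound[OF that(2)]] by (simp add: abs_mult)
  have \<phi>_int: "integrable (M1 \<Otimes>\<^sub>M M2) (\<lambda>(x, y). \<phi> x * d (x, y))"
    using prod_bound \<phi>_bound
    by (intro P.integrable_const_bound[where B = c]) (auto simp: space_pair_measure)
  have \<psi>_int: "integrable (M1 \<Otimes>\<^sub>M M2) (\<lambda>(x, y). \<psi> y * d (x, y))"
    using prod_bound \<psi>_bound
    by (intro P.integrable_const_bound[where B = c]) (auto simp: space_pair_measure)
  have d_fst: "AE x in M1. (\<integral>y. \<phi> x * d (x, y) \<partial>M2) = 0"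
    using ae(1,2) AE_space
    by eventually_elim (simp add: d_def integrable_section_fst fr hr)
  have d_snd: "AE y in M2. (\<integral>x. \<psi> y * d (x, y) \<partial>M1) = 0"
    using ae(3,4) AE_space
    by eventually_elim (simp add: d_def integrable_section_snd fr hr)
  have "(\<integral>(x, y). \<phi> x * d (x, y) \<partial>(M1 \<Otimes>\<^sub>M M2)) = 0"
    unfolding integral_fst[OF \<phi>_int, symmetric] by (rule integral_eq_zero_AE[OF d_fst])
  moreover have "(\<integral>(x, y). \<psi> y * d (x, y) \<partial>(M1 \<Otimes>\<^sub>M M2)) = 0"
    unfolding integral_snd[OF \<psi>_int, symmetric] by (rule integral_eq_zero_AE[OF d_snd])
  moreover have int: "integrable (M1 \<Otimes>\<^sub>M M2) (\<lambda>z. (case z of (x, y) \<Rightarrow> \<phi> x * d (x, y)) + (case z of (x, y) \<Rightarrow> \<psi> y * d (x, y)))"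
    using \<phi>_int \<psi>_int by (rule Bochner_Integration.integrable_add)
  ultimately have "(\<integral>z. (case z of (x, y) \<Rightarrow> \<phi> x * d (x, y)) + (case z of (x, y) \<Rightarrow> \<psi> y * d (x, y)) \<partial>(M1 \<Otimes>\<^sub>M M2)) = 0"
    using \<phi>_int \<psi>_int by simp
  moreover have "AE z in M1 \<Otimes>\<^sub>M M2. 0 \<le> (case z of (x, y) \<Rightarrow> \<phi> x * d (x, y)) + (case z of (x, y) \<Rightarrow> \<psi> y * d (x, y))"
  proof (rule AE_I2)
    fix z assume z: "z \<in> space (M1 \<Otimes>\<^sub>M M2)"
    then obtain x y where xy: "z = (x, y)" "x \<in> space M1" "y \<in> space M2"
      by (cases z) (simp add: space_pair_measure)
    have "0 \<le> (\<phi> x + \<psi> y) * d (x, y)"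
      using f1[OF xy(2,3)] f0[OF xy(2,3)] funcset_mem[OF hr z] xy(1)
      by (cases "0 < \<phi> x + \<psi> y"; cases "\<phi> x + \<psi> y < 0") (auto simp: d_def mult_nonpos_nonneg)
    then show "0 \<le> (case z of (x, y) \<Rightarrow> \<phi> x * d (x, y)) + (case z of (x, y) \<Rightarrow> \<psi> y * d (x, y))"
      by (simp add: xy distrib_right)
  qed
  ultimately have "AE z in M1 \<Otimes>\<^sub>M M2. (case z of (x, y) \<Rightarrow> \<phi> x * d (x, y)) + (case z of (x, y) \<Rightarrow> \<psi> y * d (x, y)) = 0"
    using integral_nonneg_eq_0_iff_AE[OF int] by blast
  with nz show ?thesis
    by eventually_elim (auto simp: d_def case_prod_beta simp flip: distrib_right)
qed

lemma (in pair_prob_space) marginals_AE_unique: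
  assumes f: "has_marginals M1 M2 f a b" and h: "has_marginals M1 M2 h c d"
    and eq: "AE z in M1 \<Otimes>\<^sub>M M2. f z = h z"
  shows "AE x in M1. a x = c x" "AE y in M2. b y = d y"
proof -
  have [measurable]: "f \<in> borel_measurable (M1 \<Otimes>\<^sub>M M2)" "h \<in> borel_measurable (M1 \<Otimes>\<^sub>M M2)"
    and ae: "AE x in M1. a x = (\<integral>y. f (x, y) \<partial>M2)" "AE x in M1. c x = (\<integral>y. h (x, y) \<partial>M2)"
       "AE y in M2. b y = (\<integral>x. f (x, y) \<partial>M1)" "AE y in M2. d y = (\<integral>x. h (x, y) \<partial>M1)"
    using f h by (auto simp: has_marginals_def)
  show "AE x in M1. a x = c x"
    using ae(1,2) AE_pair[OF eq] AE_space
  proof eventually_elim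
    case (elim x)
    have "(\<integral>y. f (x, y) \<partial>M2) = (\<integral>y. h (x, y) \<partial>M2)"
      by (rule integral_cong_AE) (use elim in auto)
    with elim show ?case
      by simp
  qed
  show "AE y in M2. b y = d y"
    using ae(3,4) AE_pair_snd[OF eq] AE_space
  proof eventually_elim
    case (elim y)
    have "(\<integral>x. f (x, y) \<partial>M1) = (\<integral>x. h (x, y) \<partial>M1)"
      by (rule integral_cong_AE) (use elim in auto)
    with elim show ?case
      by simp
  qed
qed

lemma has_marginals_cong_AE:
  assumes "has_marginals M N f a b" "AE x in M. a x = c x" "AE y in N. b y = d y"
  shows "has_marginals M N f c d"
  using assms by (auto simp: has_marginals_def elim: eventually_elim2)

lemma rationalizable_borel:
  assumes "rationalizable q"
  shows "\<exists>f. has_marginals \<I> \<I> f (fst q) (snd q)"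
  using assms rationalizes_borel unfolding rationalizable_def by blast

lemma ae_eq_iff: "ae_eq p q \<longleftrightarrow> (AE t in \<I>. fst p t = fst q t) \<and> (AE t in \<I>. snd p t = snd q t)"
  by (simp add: ae_eq_def AE_lebesgue_on_unit_interval)

text \<open>Off the graph of its lower boundary \<open>g\<close> an up-set is the region above the
  graph, so the threshold argument applies with \<open>\<phi> = - g\<close> and
  \<open>\<psi>\<close> the identity.\<close>

lemma up_set_uniquely_rationalizes:
  assumes A: "up_set A" and rat: "rationalizes (indicator A) q"
  shows "uniquely_rationalizes (indicator A) q"
proof -
  \<comment> \<open>The inserted 1 is the height of columns that miss \<open>A\<close>; it keeps
    \<open>g\<close> in \<open>{0..1}\<close>.\<close>
  define g where "g x = Inf (insert 1 {y \<in> {0..1}. (x, y) \<in> A})" for x :: real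
  have bdd: "bdd_below (insert 1 {y \<in> {0..1}. (x, y) \<in> A})" for x :: real
    by (rule bdd_belowI[of _ 0]) auto
  have g_le: "g x \<le> y" if "(x, y) \<in> A" "y \<in> {0..1}" for x y
    unfolding g_def using that bdd by (intro cInf_lower) auto
  have g01: "0 \<le> g x" "g x \<le> 1" for x
    unfolding g_def using bdd by (auto intro!: cInf_greatest cInf_lower)
  have g_less: "(x, y) \<in> A" if "g x < y" "x \<in> {0..1}" "y \<in> {0..1}" for x y
  proof -
    obtain y' where "y' \<in> insert 1 {y \<in> {0..1}. (x, y) \<in> A}" "y' < y"
      using \<open>g x < y\<close> unfolding g_def by (subst (asm) cInf_less_iff[OF _ bdd]) auto
    then show ?thesis
      using A that by (auto simp: up_set_def)
  qed
  \<comment> \<open>Columns of an up-set grow with \<open>x\<close>, so the boundary descends;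
    monotonicity yields Borel measurability.\<close>
  have "mono_on {0..1} (\<lambda>x. - g x)"
  proof (rule mono_onI)
    fix x x' :: real assume x: "x \<in> {0..1}" "x' \<in> {0..1}" "x \<le> x'"
    have "(x', y) \<in> A" if "(x, y) \<in> A" "y \<in> {0..1}" for y
      using A that x by (auto simp: up_set_def)
    then have "g x' \<le> g x"
      unfolding g_def by (intro cInf_superset_mono bdd) auto
    then show "- g x \<le> - g x'"
      by simp
  qed
  then have g_neg: "(\<lambda>x. - g x) \<in> borel_measurable (restrict_space borel {0..1})"
    by (rule borel_measurable_mono_on_fnc)
  have g_meas'[measurable]: "(\<lambda>x. - g x) \<in> borel_measurable \<I>"
    using g_neg by (simp cong: measurable_cong_sets add: sets_restrict_space)
  have g_meas[measurable]: "g \<in> borel_measurable \<I>"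
    using borel_measurable_uminus[OF g_meas'] by simp
  have id_meas[measurable]: "(\<lambda>y. y) \<in> borel_measurable \<I>"
    by (rule measurable_restrict_space1) simp
  \<comment> \<open>A Borel stand-in for \<open>indicator A\<close>, which need not be Borel
    itself.\<close>
  define B where "B z = (if g (fst z) \<le> snd z then 1 else 0 :: real)" for z
  have B_meas: "B \<in> borel_measurable (\<I> \<Otimes>\<^sub>M \<I>)"
    unfolding B_def by measurable
  have B_range: "B \<in> unit_square \<rightarrow> {0..1}"
    by (simp add: B_def)
  \<comment> \<open>The graph of \<open>g\<close> is null by Fubini: it meets each column in at most
    one point.\<close>
  have nz: "AE z in \<I> \<Otimes>\<^sub>M \<I>. - g (fst z) + snd z \<noteq> 0"
  proof (rule II.AE_pair_measure)
    show "{z \<in> space (\<I> \<Otimes>\<^sub>M \<I>). - g (fst z) + snd z \<noteq> 0} \<in> sets (\<I> \<Otimes>\<^sub>M \<I>)"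
      by measurable
    have "AE y in \<I>. y \<noteq> g x" for x
      using AE_lborel_singleton[of "g x"] by (simp add: AE_restrict_space_iff eventually_mono)
    then show "AE x in \<I>. AE y in \<I>. - g (fst (x, y)) + snd (x, y) \<noteq> 0"
      by (auto elim: eventually_mono)
  qed
  then have AB: "AE z in \<I> \<Otimes>\<^sub>M \<I>. indicator A z = B z"
    using AE_space
  proof eventually_elim
    case (elim z)
    then show ?case
      using g_le[of "fst z" "snd z"] g_less[of "fst z" "snd z"]
      by (cases z) (auto simp: B_def indicator_def space_pair_measure)
  qed
  have BQ: "has_marginals \<I> \<I> B (fst q) (snd q)"
    using rat rationalizes_cong_AE[OF B_meas B_range _ AB] by simp
  have "AE z in \<I> \<Otimes>\<^sub>M \<I>. h z = indicator A z" if h: "rationalizes h q" for h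
  proof -
    obtain h' where h': "has_marginals \<I> \<I> h' (fst q) (snd q)" "AE z in \<I> \<Otimes>\<^sub>M \<I>. h z = h' z"
      using rationalizes_borel[OF h] by blast
    have "AE z in \<I> \<Otimes>\<^sub>M \<I>. h' z = B z"
      by (rule II.threshold_rationalization_unique[OF BQ h'(1), of "\<lambda>x. - g x" 1 "\<lambda>y. y"])
        (use g01 nz in \<open>auto simp: B_def\<close>)
    with h'(2) AB show ?thesis
      by eventually_elim simp
  qed
  with rat show ?thesis
    by (simp add: uniquely_rationalizes_def AE_lebesgue_on_unit_square)
qed

text \<open>Mixing rationalizations of \<open>p\<close> and \<open>r\<close> rationalizes
  \<open>q\<close>, so the mixture is the indicator almost everywhere. As 0 and 1 are extreme in
  \<open>{0..1}\<close>, the two rationalizations agree, and with them the marginals.\<close>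

lemma extreme_point_if_uniquely_rationalized_by_indicator:
  assumes q: "q \<in> rationalizable_pairs" and uniq: "uniquely_rationalizes (indicator A) q"
  shows "q L1_extreme_point_of rationalizable_pairs"
  unfolding L1_extreme_point_of_def
proof (intro conjI ballI notI)
  fix p r assume p: "p \<in> rationalizable_pairs" and r: "r \<in> rationalizable_pairs"
    and "\<not> ae_eq p r \<and> (\<exists>u. 0 < u \<and> u < 1 \<and> ae_eq q (mixture u p r))"
  then obtain u where neq: "\<not> ae_eq p r" and u: "0 < u" "u < 1" and eq: "ae_eq q (mixture u p r)"
    by blast
  obtain f where f: "has_marginals \<I> \<I> f (fst p) (snd p)"
    using p rationalizable_borel[of p] by (auto simp: rationalizable_pairs_def)
  obtain h where h: "has_marginals \<I> \<I> h (fst r) (snd r)"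
    using r rationalizable_borel[of r] by (auto simp: rationalizable_pairs_def)
  have "has_marginals \<I> \<I> (\<lambda>z. (1 - u) * f z + u * h z) (fst (mixture u p r)) (snd (mixture u p r))"
    using II.has_marginals_convex[OF f h, of u] u by (simp add: mixture_def)
  then have "has_marginals \<I> \<I> (\<lambda>z. (1 - u) * f z + u * h z) (fst q) (snd q)"
    by (rule has_marginals_cong_AE) (use eq in \<open>auto simp: ae_eq_iff elim: eventually_mono\<close>)
  then have "rationalizes (\<lambda>z. (1 - u) * f z + u * h z) q"
    using rationalizes_of_has_marginals by fastforce
  then have "AE z in \<I> \<Otimes>\<^sub>M \<I>. (1 - u) * f z + u * h z = indicator A z"
    using uniq by (simp add: uniquely_rationalizes_def AE_lebesgue_on_unit_square)
  then have "AE z in \<I> \<Otimes>\<^sub>M \<I>. f z = h z"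
    using AE_space
  proof eventually_elim
    case (elim z)
    have fh: "0 \<le> f z" "f z \<le> 1" "0 \<le> h z" "h z \<le> 1"
      using f h elim(2) by (auto simp: has_marginals_def Pi_iff)
    show ?case
    \<comment> \<open>On \<open>A\<close> the weighted distances of both values from 1 sum to zero,
      off \<open>A\<close> the weighted values themselves do.\<close>
    proof (cases "z \<in> A")
      case True
      with elim have "(1 - u) * (1 - f z) + u * (1 - h z) = 0"
        by (simp add: algebra_simps)
      moreover have "0 \<le> (1 - u) * (1 - f z)" "0 \<le> u * (1 - h z)"
        using u fh by auto
      ultimately have "(1 - u) * (1 - f z) = 0" "u * (1 - h z) = 0"
        by linarith+
      with u show ?thesis
        by simp
    next
      case False
      with elim have "(1 - u) * f z + u * h z = 0"
        by simp
      moreover have "0 \<le> (1 - u) * f z" "0 \<le> u * h z"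
        using u fh by auto
      ultimately have "(1 - u) * f z = 0" "u * h z = 0"
        by linarith+
      with u show ?thesis
        by simp
    qed
  qed
  with neq II.marginals_AE_unique[OF f h] show False
    by (simp add: ae_eq_iff)
qed (rule q)

section \<open>Extreme points come from up-sets\<close>

lemma minimal_energy_mono_fst:
  assumes f: "minimal_energy \<I> \<I> f a b" and a: "mono_on {0..1} a"
  shows "AE z in \<I> \<Otimes>\<^sub>M \<I>. fst z < snd z \<longrightarrow> (AE y in \<I>. f (fst z, y) \<le> f (snd z, y))"
  using II.minimal_energy_mono[OF f] AE_space
  by eventually_elim (use mono_onD[OF a] in \<open>auto simp: space_pair_measure\<close>)

text \<open>A nondecreasing \<open>\<phi>\<close> preserves the almost-everywhere order of the
  columns of \<open>f\<close>, so the column integrals increase almost everywhere and have a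
  left-continuous monotone version.\<close>

lemma ex_monotone_lc_marginal:
  assumes f: "minimal_energy \<I> \<I> f a b" and a: "mono_on {0..1} a"
    and \<phi>[measurable]: "\<phi> \<in> borel_measurable borel" and \<phi>_range: "\<phi> \<in> {0..1} \<rightarrow> {0..1::real}"
    and \<phi>_mono: "mono_on {0..1} \<phi>"
  shows "\<exists>P. monotone_lc P \<and> (AE x in \<I>. P x = (\<integral>y. \<phi> (f (x, y)) \<partial>\<I>))"
proof (rule ex_monotone_lc_version)
  have [measurable]: "f \<in> borel_measurable (\<I> \<Otimes>\<^sub>M \<I>)" and fr: "f \<in> unit_square \<rightarrow> {0..1}"
    using f by (auto simp: minimal_energy_def has_marginals_def space_pair_measure)
  have \<phi>f: "(\<phi> \<circ> f) \<in> borel_measurable (\<I> \<Otimes>\<^sub>M \<I>)" "(\<phi> \<circ> f) \<in> space (\<I> \<Otimes>\<^sub>M \<I>) \<rightarrow> {0..1}"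
    using fr \<phi>_range by (auto simp: comp_def space_pair_measure Pi_iff)
  have int: "integrable \<I> (\<lambda>y. \<phi> (f (x, y)))" if "x \<in> {0..1}" for x
    using II.integrable_section_fst[OF \<phi>f, of x] that by (simp add: comp_def)
  show "(\<lambda>x. \<integral>y. \<phi> (f (x, y)) \<partial>\<I>) \<in> {0..1} \<rightarrow> {0..1}"
  proof
    fix x :: real assume x: "x \<in> {0..1}"
    have "AE y in \<I>. \<phi> (f (x, y)) \<in> {0..1}"
      using fr \<phi>_range x by (intro AE_I2) (auto simp: Pi_iff)
    then show "(\<integral>y. \<phi> (f (x, y)) \<partial>\<I>) \<in> {0..1}"
      using I.integral_ge_const[OF int[OF x], of 0] I.integral_le_const[OF int[OF x], of 1]
      by (auto elim: eventually_mono)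
  qed
  show "AE z in \<I> \<Otimes>\<^sub>M \<I>. fst z < snd z \<longrightarrow> (\<integral>y. \<phi> (f (fst z, y)) \<partial>\<I>) \<le> (\<integral>y. \<phi> (f (snd z, y)) \<partial>\<I>)"
    using minimal_energy_mono_fst[OF f a] AE_space
  proof eventually_elim
    case (elim z)
    have z: "fst z \<in> {0..1}" "snd z \<in> {0..1}"
      using elim(2) by (auto simp: space_pair_measure)
    show ?case
    proof
      assume "fst z < snd z"
      with elim(1) have "AE y in \<I>. f (fst z, y) \<le> f (snd z, y)"
        by blast
      then have "AE y in \<I>. \<phi> (f (fst z, y)) \<le> \<phi> (f (snd z, y))"
        using AE_space by eventually_elim (use z fr mono_onD[OF \<phi>_mono] in \<open>auto simp: Pi_iff\<close>)
      then show "(\<integral>y. \<phi> (f (fst z, y)) \<partial>\<I>) \<le> (\<integral>y. \<phi> (f (snd z, y)) \<partial>\<I>)"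
        by (intro integral_mono_AE int z)
    qed
  qed
qed

text \<open>Supplies the competitors for the extreme point argument; the second marginal is treated
  through the transpose of \<open>f\<close>.\<close>

lemma ex_rationalizable_pair_of_transform:
  assumes f: "minimal_energy \<I> \<I> f a b" and ab: "mono_on {0..1} a" "mono_on {0..1} b"
    and \<phi>[measurable]: "\<phi> \<in> borel_measurable borel" and \<phi>_range: "\<phi> \<in> {0..1} \<rightarrow> {0..1::real}"
    and \<phi>_mono: "mono_on {0..1} \<phi>"
  shows "\<exists>p \<in> rationalizable_pairs. has_marginals \<I> \<I> (\<phi> \<circ> f) (fst p) (snd p)"
proof -
  obtain P1 where P1: "monotone_lc P1" "AE x in \<I>. P1 x = (\<integral>y. \<phi> (f (x, y)) \<partial>\<I>)"
    using ex_monotone_lc_marginal[OF f ab(1) \<phi> \<phi>_range \<phi>_mono] by blast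
  obtain P2 where P2: "monotone_lc P2" "AE y in \<I>. P2 y = (\<integral>x. \<phi> (f (x, y)) \<partial>\<I>)"
    using ex_monotone_lc_marginal[OF II.minimal_energy_swap[OF f] ab(2) \<phi> \<phi>_range \<phi>_mono] by auto
  have [measurable]: "f \<in> borel_measurable (\<I> \<Otimes>\<^sub>M \<I>)" and fr: "f \<in> unit_square \<rightarrow> {0..1}"
    using f by (auto simp: minimal_energy_def has_marginals_def space_pair_measure)
  have m: "has_marginals \<I> \<I> (\<phi> \<circ> f) P1 P2"
    unfolding has_marginals_def
    using P1 P2 fr \<phi>_range by (auto simp: comp_def space_pair_measure Pi_iff)
  then have "(P1, P2) \<in> rationalizable_pairs"
    using P1 P2 rationalizes_of_has_marginals[OF m]
    by (auto simp: rationalizable_pairs_def rationalizable_def)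
  with m show ?thesis
    by (intro bexI[of _ "(P1, P2)"]) auto
qed

lemma extreme_point_two_valued:
  assumes ext: "q L1_extreme_point_of rationalizable_pairs"
    and f: "minimal_energy \<I> \<I> f (fst q) (snd q)"
  shows "AE z in \<I> \<Otimes>\<^sub>M \<I>. f z = 0 \<or> f z = 1"
proof -
  have mono: "mono_on {0..1} (fst q)" "mono_on {0..1} (snd q)"
    using ext by (auto simp: L1_extreme_point_of_def rationalizable_pairs_def monotone_lc_def)
  have fm: "has_marginals \<I> \<I> f (fst q) (snd q)"
    using f by (simp add: minimal_energy_def)
  then have fr: "f \<in> space (\<I> \<Otimes>\<^sub>M \<I>) \<rightarrow> {0..1}" and fmeas[measurable]: "f \<in> borel_measurable (\<I> \<Otimes>\<^sub>M \<I>)"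
    by (auto simp: has_marginals_def)
  \<comment> \<open>Both maps are nondecreasing on \<open>{0..1}\<close>, their mean is the
    identity, and their difference \<open>min (2 * t) (2 - 2 * t)\<close> is nonnegative there with
    zeros only at 0 and 1.\<close>
  let ?lo = "\<lambda>t::real. min 1 (2 * t)" and ?hi = "\<lambda>t::real. max 0 (2 * t - 1)"
  have lo: "\<exists>p \<in> rationalizable_pairs. has_marginals \<I> \<I> (?lo \<circ> f) (fst p) (snd p)"
    by (rule ex_rationalizable_pair_of_transform[OF f mono]) (auto intro!: mono_onI)
  have hi: "\<exists>p \<in> rationalizable_pairs. has_marginals \<I> \<I> (?hi \<circ> f) (fst p) (snd p)"
    by (rule ex_rationalizable_pair_of_transform[OF f mono]) (auto intro!: mono_onI)
  obtain p where p: "p \<in> rationalizable_pairs" "has_marginals \<I> \<I> (?lo \<circ> f) (fst p) (snd p)"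
    using lo by blast
  obtain r where r: "r \<in> rationalizable_pairs" "has_marginals \<I> \<I> (?hi \<circ> f) (fst r) (snd r)"
    using hi by blast
  have "(\<lambda>z. (1 - 1/2) * (?lo \<circ> f) z + 1/2 * (?hi \<circ> f) z) = f"
    by (auto simp: fun_eq_iff min_def max_def field_simps)
  then have mix: "has_marginals \<I> \<I> f (fst (mixture (1/2) p r)) (snd (mixture (1/2) p r))"
    using II.has_marginals_convex[OF p(2) r(2), of "1/2"] by (simp add: mixture_def)
  then have "ae_eq q (mixture (1/2) p r)"
    using II.marginals_AE_unique[OF fm mix] by (simp add: ae_eq_iff)
  moreover have "(0::real) < 1/2" "1/2 < (1::real)"
    by simp_all
  ultimately have "ae_eq p r"
    using ext p(1) r(1) unfolding L1_extreme_point_of_def by blast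
  \<comment> \<open>Since \<open>p\<close> and \<open>r\<close> agree, both transforms have the same
    first marginal and hence the same integral over the square.\<close>
  have "has_marginals \<I> \<I> (?hi \<circ> f) (fst p) (snd p)"
    by (rule has_marginals_cong_AE[OF r(2)])
      (use \<open>ae_eq p r\<close> in \<open>auto simp: ae_eq_iff elim: eventually_mono\<close>)
  then have lo_hi: "AE x in \<I>. (\<integral>y. (?lo \<circ> f) (x, y) \<partial>\<I>) = (\<integral>y. (?hi \<circ> f) (x, y) \<partial>\<I>)"
    using p(2) by (auto simp: has_marginals_def elim: eventually_elim2)
  note int = II.integrable_of_has_marginals[OF p(2)] II.integrable_of_has_marginals[OF r(2)]
  have "(\<integral>z. (?lo \<circ> f) z \<partial>(\<I> \<Otimes>\<^sub>M \<I>)) = (\<integral>x. \<integral>y. (?lo \<circ> f) (x, y) \<partial>\<I> \<partial>\<I>)"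
    by (rule II.integral_fst'[OF int(1), symmetric])
  also have "\<dots> = (\<integral>x. \<integral>y. (?hi \<circ> f) (x, y) \<partial>\<I> \<partial>\<I>)"
    by (rule integral_cong_AE[OF _ _ lo_hi])
      (intro borel_measurable_integrable II.integrable_fst' int)+
  also have "\<dots> = (\<integral>z. (?hi \<circ> f) z \<partial>(\<I> \<Otimes>\<^sub>M \<I>))"
    by (rule II.integral_fst'[OF int(2)])
  finally have "(\<integral>z. (?lo \<circ> f) z - (?hi \<circ> f) z \<partial>(\<I> \<Otimes>\<^sub>M \<I>)) = 0"
    by (simp only: Bochner_Integration.integral_diff[OF int] right_minus_eq)
  moreover have "AE z in \<I> \<Otimes>\<^sub>M \<I>. 0 \<le> (?lo \<circ> f) z - (?hi \<circ> f) z"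
    using fr by (intro AE_I2) (fastforce simp: Pi_iff)
  ultimately have "AE z in \<I> \<Otimes>\<^sub>M \<I>. (?lo \<circ> f) z - (?hi \<circ> f) z = 0"
    using integral_nonneg_eq_0_iff_AE[OF Bochner_Integration.integrable_diff[OF int]] by blast
  then show ?thesis
    by eventually_elim (auto simp: min_def max_def split: if_splits)
qed

text \<open>Almost every section of the minimizer is two-valued, monotone and of integral
  \<open>fst q x\<close>, hence the indicator of \<open>{1 - fst q x..1}\<close>. These segments
  grow with \<open>x\<close>.\<close>

lemma extreme_point_rationalized_by_up_set:
  assumes ext: "q L1_extreme_point_of rationalizable_pairs"
  shows "\<exists>A. up_set A \<and> rationalizes (indicator A) q"
proof -
  have q: "q \<in> rationalizable_pairs"
    using ext by (simp add: L1_extreme_point_of_def)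
  then have mono: "mono_on {0..1} (fst q)" "mono_on {0..1} (snd q)"
    and q01: "fst q \<in> {0..1} \<rightarrow> {0..1}"
    by (auto simp: rationalizable_pairs_def monotone_lc_def)
  obtain f0 where "has_marginals \<I> \<I> f0 (fst q) (snd q)"
    using q rationalizable_borel[of q] by (auto simp: rationalizable_pairs_def)
  then obtain f where f: "minimal_energy \<I> \<I> f (fst q) (snd q)"
    using II.ex_minimal_energy by blast
  then have fm: "has_marginals \<I> \<I> f (fst q) (snd q)"
    by (simp add: minimal_energy_def)
  then have [measurable]: "f \<in> borel_measurable (\<I> \<Otimes>\<^sub>M \<I>)"
    by (simp add: has_marginals_def)
  interpret T: pair_prob_space \<I> "\<I> \<Otimes>\<^sub>M \<I>" ..
  have id_meas[measurable]: "(\<lambda>y. y) \<in> borel_measurable \<I>"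
    by (rule measurable_restrict_space1) simp
  \<comment> \<open>Monotonicity in the second coordinate is column comparison for the transpose. It
    comes with the pair of heights first; \<open>AE_commute\<close> puts \<open>x\<close> first, as
    needed for statements about single sections.\<close>
  have "AE w in \<I> \<Otimes>\<^sub>M \<I>. AE x in \<I>. fst w < snd w \<longrightarrow> f (x, fst w) \<le> f (x, snd w)"
    using minimal_energy_mono_fst[OF II.minimal_energy_swap[OF f] mono(2)]
    by (auto elim!: eventually_mono)
  moreover have "{z \<in> space (\<I> \<Otimes>\<^sub>M (\<I> \<Otimes>\<^sub>M \<I>)). fst (snd z) < snd (snd z)
      \<longrightarrow> f (fst z, fst (snd z)) \<le> f (fst z, snd (snd z))} \<in> sets (\<I> \<Otimes>\<^sub>M (\<I> \<Otimes>\<^sub>M \<I>))"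
    by measurable
  ultimately have f_mono: "AE x in \<I>. AE w in \<I> \<Otimes>\<^sub>M \<I>. fst w < snd w \<longrightarrow> f (x, fst w) \<le> f (x, snd w)"
    by (subst T.AE_commute)
  have marg: "AE x in \<I>. fst q x = (\<integral>y. f (x, y) \<partial>\<I>)"
    using fm by (simp add: has_marginals_def)
  \<comment> \<open>The threshold uses \<open>fst q\<close>, which is monotone at every point, so
    that the resulting set is an up-set without exceptions.\<close>
  define B where "B z = (if 1 - fst q (fst z) \<le> snd z then 1 else 0 :: real)" for z
  have q_meas[measurable]: "fst q \<in> borel_measurable \<I>"
    using borel_measurable_mono_on_fnc[OF mono(1)]
    by (simp cong: measurable_cong_sets add: sets_restrict_space)
  have B_meas[measurable]: "B \<in> borel_measurable (\<I> \<Otimes>\<^sub>M \<I>)"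
    unfolding B_def by measurable
  have B_range: "B \<in> unit_square \<rightarrow> {0..1}"
    by (simp add: B_def)
  have fB: "AE z in \<I> \<Otimes>\<^sub>M \<I>. f z = B z"
  proof (rule II.AE_pair_measure)
    show "{z \<in> space (\<I> \<Otimes>\<^sub>M \<I>). f z = B z} \<in> sets (\<I> \<Otimes>\<^sub>M \<I>)"
      by measurable
    show "AE x in \<I>. AE y in \<I>. f (x, y) = B (x, y)"
      using II.AE_pair[OF extreme_point_two_valued[OF ext f]] f_mono marg AE_space
    proof eventually_elim
      case (elim x)
      have "(\<lambda>y. f (x, y)) \<in> borel_measurable \<I>"
        using elim(4) by measurable
      from ae_mono_indicator[OF this elim(2,1)] elim(3) show ?case
        by (simp add: B_def)
    qed
  qed
  let ?A = "{z \<in> unit_square. 1 - fst q (fst z) \<le> snd z}"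
  have AB: "AE z in \<I> \<Otimes>\<^sub>M \<I>. indicator ?A z = B z"
    by (rule AE_I2) (auto simp: B_def space_pair_measure indicator_def)
  have "has_marginals \<I> \<I> B (fst q) (snd q)"
  proof -
    have "rationalizes f q"
      using rationalizes_of_has_marginals[OF fm] by simp
    moreover have "f \<in> unit_square \<rightarrow> {0..1}"
      using fm by (auto simp: has_marginals_def space_pair_measure)
    ultimately show ?thesis
      using rationalizes_cong_AE[OF B_meas B_range _ fB] by simp
  qed
  then have "rationalizes (indicator ?A) q"
    using rationalizes_cong_AE[OF B_meas B_range _ AB] by simp
  moreover have "up_set ?A"
    unfolding up_set_def
  proof (intro conjI ballI impI)
    fix z w assume "z \<in> ?A" "w \<in> unit_square" "z \<le> w"
    then show "w \<in> ?A"
      using mono_onD[OF mono(1), of "fst z" "fst w"] by (auto simp: less_eq_prod_def)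
  qed auto
  ultimately show ?thesis
    by blast
qed

theorem theorem3:
  fixes q :: "(real \<Rightarrow> real) \<times> (real \<Rightarrow> real)"
  assumes "monotone_lc (fst q)" and "monotone_lc (snd q)"
  shows "(q L1_extreme_point_of rationalizable_pairs \<longleftrightarrow>
            (\<exists>A. up_set A \<and> rationalizes (indicator A) q)) \<and>
         (q L1_extreme_point_of rationalizable_pairs \<longrightarrow> uniquely_rationalized q)"
proof (intro conjI iffI impI)
  assume "\<exists>A. up_set A \<and> rationalizes (indicator A) q"
  then obtain A where A: "up_set A" "rationalizes (indicator A) q"
    by blast
  then have "q \<in> rationalizable_pairs"
    using assms by (auto simp: rationalizable_pairs_def rationalizable_def)
  then show "q L1_extreme_point_of rationalizable_pairs"
    using up_set_uniquely_rationalizes[OF A]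
    by (rule extreme_point_if_uniquely_rationalized_by_indicator)
next
  assume ext: "q L1_extreme_point_of rationalizable_pairs"
  show "\<exists>A. up_set A \<and> rationalizes (indicator A) q"
    using ext by (rule extreme_point_rationalized_by_up_set)
  then show "uniquely_rationalized q"
    using up_set_uniquely_rationalizes unfolding uniquely_rationalized_def by blast
qed

end
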